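(* Let a Heun equation $(\mathfrak H)$ with parameters $d,q,\alpha,\beta,\gamma,\delta,\epsilon$ be given which has four singular points and is nontrivial (i.e. $\alpha\beta\neq0$ or $q\neq0$), and let $R$ be a rational function. The Heun equation can be transformed to a hypergeometric equation $(\mathfrak h)$ (for some $a,b,c\in\mathbb C$) by the rational substitution $z=R(t)$ if and only if $R$ is a polynomial, $\alpha\beta\neq0$, and one of the following two conditions is satisfied. (1) $\triangle 01d$ is similar to $\triangle 01D$ for one of the (real) values of $D$ listed in subcases (1a)--(1c) below (so the triangle is degenerate), the normalized accessory parameter $q/\alpha\beta$ equals one of $0,1,d$, and, for some complex affine map $A$ with $A(\{0,1,d\})=\{0,1,D\}$, all the requirements listed in that subcase hold. (2) $\triangle 01d$ is similar to $\triangle 01D$ for one of the (non-real, with real part $\frac12$) values of $D$ listed in subcases (2a)--(2d) below (so the triangle is isosceles), and, for some complex affine map $A$ with $A(\{0,1,d\})=\{0,1,D\}$, all the requirements listed in that subcase hold. In every subcase a value $p_0$, a polynomial $P$ and restrictions on exponent parameters are listed; the requirements are: $A(q/\alpha\beta)=p_0$; the listed restrictions on the exponent parameters hold, where for $x\in\{0,1,D\}$ the symbol $\kappa_x$ denotes the exponent parameter ($\gamma$, $\delta$ or $\epsilon$) belonging to the singular point $A^{-1}(x)$ ($0$, $1$ or $d$, respectively); and either $R$ or $S=1-R$ equals $P\circ A$. (1a) [Harmonic case] $D=2$, $p_0=1$, $\kappa_0=\kappa_2$, $P(t)=t(2-t)$ (degree 2; it maps $0,2$ to $0$, and $1$ to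 $1$ with double multiplicity). (1b) $D=4$, $p_0=1$, $1-\kappa_1=2(1-\kappa_4)$, $\kappa_0=\frac12$, $P(t)=(t-1)^2(1-t/4)$ (degree 3; it maps $0$ to $1$ and $1,4$ to $0$, the former with double multiplicity). (1c) [Special harmonic case] $D=2$, $p_0=1$, $\kappa_0=\kappa_2$, $1-\kappa_1=2(1-\kappa_0)=2(1-\kappa_2)$, $P(t)=4[t(2-t)-\frac12]^2$ (degree 4; it maps $0,1,2$ to $1$, the point $1$ with double multiplicity). (2a) [Equianharmonic case] $D=\frac12+\mathrm i\frac{\sqrt3}2$, $p_0=\frac12+\mathrm i\frac{\sqrt3}6$ (so $q/\alpha\beta$ is the mean of $0,1,d$), $\gamma=\delta=\epsilon$, $P(t)=\left[1-t/(\frac12+\mathrm i\frac{\sqrt3}6)\right]^3$ (degree 3; it maps $0,1,D$ to $1$ and $p_0$ to $0$ with triple multiplicity). (2b) $D=\frac12+\mathrm i\frac{5\sqrt2}4$, $p_0=\frac12+\mathrm i\frac{\sqrt2}4$, $\kappa_D=\frac23$, $\kappa_0=\kappa_1=\frac12$, $P(t)=\left[1-t/(\frac12+\mathrm i\frac{5\sqrt2}4)\right]\left[1-t/(\frac12+\mathrm i\frac{\sqrt2}4)\right]^3$ (degree 4; it maps $D,p_0$ to $0$, the latter with triple multiplicity, and $0,1$ to $1$). (2c) $D=\frac12+\mathrm i\frac{11\sqrt{15}}{90}$, $p_0=\frac12+\mathrm i\frac{\sqrt{15}}{18}$, $\kappa_D=\frac12$, $\kappa_0=\kappa_1=\frac23$,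 $P(t)=-\mathrm i\frac{2025\sqrt{15}}{64}\,t(t-1)\left[t-(\frac12+\mathrm i\frac{\sqrt{15}}{18})\right]^3$ (degree 5; it maps $0,1,p_0$ to $0$, the last with triple multiplicity, and $D$ to $1$). (2d) [Special equianharmonic case] $D=\frac12+\mathrm i\frac{\sqrt3}2$, $p_0=\frac12+\mathrm i\frac{\sqrt3}6$ (so $q/\alpha\beta$ is the mean of $0,1,d$), $\gamma=\delta=\epsilon=\frac23$, $P(t)=4\left\{\left[1-t/(\frac12+\mathrm i\frac{\sqrt3}6)\right]^3-\frac12\right\}^2$ (degree 6; it maps $0,1,D,p_0$ to $1$, the last with triple multiplicity).
   Context: The hypergeometric equation $(\mathfrak h)$ with parameters $a,b,c\in\mathbb C$ is $$\frac{d^2y}{dz^2}+\left(\frac cz+\frac{a+b-c+1}{z-1}\right)\frac{dy}{dz}+\frac{ab}{z(z-1)}\,y=0 .$$ The Heun equation $(\mathfrak H)$ with parameters $d\in\mathbb C\setminus\{0,1\}$, $q,\alpha,\beta,\gamma,\delta,\epsilon\in\mathbb C$ subject to $\alpha+\beta-\gamma-\delta-\epsilon+1=0$ is $$\frac{d^2u}{dt^2}+\left(\frac\gamma t+\frac\delta{t-1}+\frac\epsilon{t-d}\right)\frac{du}{dt}+\frac{\alpha\beta t-q}{t(t-1)(t-d)}\,u=0 .$$ Its characteristic exponents are $0,1-\gamma$ at $t=0$; $0,1-\delta$ at $t=1$; $0,1-\epsilon$ at $t=d$; $\alpha,\beta$ at $t=\infty$. It "has four singular points" if each of $0,1,d,\infty$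 is genuinely a singular point, i.e. none of the following holds: $\gamma=0$ and $q=0$; $\delta=0$ and $q=\alpha\beta$; $\epsilon=0$ and $q=\alpha\beta d$; $\alpha\beta=0$, $\alpha+\beta=1$ and $q=0$. It is "trivial" if $\alpha\beta=0$ and $q=0$. The Heun equation is transformed (reduced) to $(\mathfrak h)$ by the substitution $z=R(t)$, with $R$ a nonconstant rational function, if substituting $z=R(t)$ into $(\mathfrak h)$ (without change of the dependent variable) yields exactly the Heun equation, i.e. the equation $$\frac{d^2y}{dt^2}+\left\{-\frac{\ddot R}{\dot R}+\frac{\dot R}{R(1-R)}[c-(a+b+1)R]\right\}\frac{dy}{dt}-\frac{ab\,\dot R^2}{R(1-R)}\,y=0$$ has the same coefficients as $(\mathfrak H)$ (dots are $t$-derivatives). $\triangle01d$ is similar to $\triangle01D$ if there is a complex affine map $A(t)=mt+n$, $m\ne0$, with $A(\{0,1,d\})=\{0,1,D\}$; degenerate (collinear) triangles are allowed. Equivalently $d\in\{D,1-D,1/D,1/(1-D),D/(D-1),(D-1)/D\}$, the corresponding maps being $A(t)=t,\ 1-t,\ Dt,\ (D-1)t+1,\ (1-D)t+D,\ D(1-t)$. *)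

theory Defs
  imports Complex_Main "HOL-Computational_Algebra.Computational_Algebra"
    "HOL-Computational_Algebra.Field_as_Ring"
begin

text \<open>
  Rational functions in one complex variable are elements of the field of fractions of the
  polynomial ring, and a second-order equation \<open>u'' + P u' + Q u = 0\<close> with rational
  coefficients is represented by \<open>P\<close> and \<open>Q\<close>. "Same coefficients" is
  thus an equality in this field, and the arithmetic below has no undefined values at poles.
\<close>

type_synonym ratfun = "complex poly fract"

abbreviation const_rf :: "complex \<Rightarrow> ratfun" where
  "const_rf c \<equiv> to_fract [:c:]"

abbreviation var_rf :: ratfun where
  "var_rf \<equiv> to_fract [:0, 1:]"

definition deriv_rf :: "ratfun \<Rightarrow> ratfun" where
  "deriv_rf R = (case quot_of_fract R of (p, q) \<Rightarrow>
     Fract (pderiv p * q - p * pderiv q) (q\<^sup>2))"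

lemma deriv_rf_Fract:
  assumes "b \<noteq> 0"
  shows "deriv_rf (Fract a b) = Fract (pderiv a * b - a * pderiv b) (b\<^sup>2)"
proof -
  obtain p q where pq: "quot_of_fract (Fract a b) = (p, q)" by fastforce
  have q: "q \<noteq> 0" using snd_quot_of_fract_nonzero[of "Fract a b"] pq by simp
  have "Fract p q = Fract a b"
    using quot_to_fract_quot_of_fract[of "Fract a b"] pq by (simp add: quot_to_fract_def)
  then have eq: "p * b = a * q" using assms q by (simp add: eq_fract)
  have d: "pderiv p * b + p * pderiv b = pderiv a * q + a * pderiv q"
    using arg_cong[OF eq, of pderiv] by (simp add: pderiv_mult algebra_simps)
  have "(pderiv p * q - p * pderiv q) * b\<^sup>2 - (pderiv a * b - a * pderiv b) * q\<^sup>2 =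
      b * q * (pderiv p * b + p * pderiv b - (pderiv a * q + a * pderiv q))
      - (p * b - a * q) * (pderiv b * q + pderiv q * b)"
    by (simp add: power2_eq_square algebra_simps)
  then have "(pderiv p * q - p * pderiv q) * b\<^sup>2 = (pderiv a * b - a * pderiv b) * q\<^sup>2"
    using eq d by simp
  then show ?thesis
    using assms q by (simp add: deriv_rf_def pq eq_fract)
qed

text \<open>The coefficients of the hypergeometric equation, evaluated at a rational function \<open>z\<close>.\<close>

definition hypergeom_coeff1 :: "complex \<Rightarrow> complex \<Rightarrow> complex \<Rightarrow> ratfun \<Rightarrow> ratfun" where
  "hypergeom_coeff1 a b c z = const_rf c / z + const_rf (a + b - c + 1) / (z - 1)"

definition hypergeom_coeff0 :: "complex \<Rightarrow> complex \<Rightarrow> ratfun \<Rightarrow> ratfun" where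
  "hypergeom_coeff0 a b z = const_rf (a * b) / (z * (z - 1))"

definition heun_coeff1 :: "complex \<Rightarrow> complex \<Rightarrow> complex \<Rightarrow> complex \<Rightarrow> ratfun" where
  "heun_coeff1 d \<gamma> \<delta> \<epsilon> =
     const_rf \<gamma> / var_rf + const_rf \<delta> / (var_rf - 1) + const_rf \<epsilon> / (var_rf - const_rf d)"

definition heun_coeff0 :: "complex \<Rightarrow> complex \<Rightarrow> complex \<Rightarrow> complex \<Rightarrow> ratfun" where
  "heun_coeff0 d q \<alpha> \<beta> =
     (const_rf (\<alpha> * \<beta>) * var_rf - const_rf q) / (var_rf * (var_rf - 1) * (var_rf - const_rf d))"

text \<open>
  Under \<open>z = R(t)\<close> one has \<open>dy/dz = y' / R'\<close> and
  \<open>d\<^sup>2y/dz\<^sup>2 = (y'' - (R''/R') y') / R'\<^sup>2\<close>; multiplying the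
  equation by \<open>R'\<^sup>2\<close> gives the monic equation in \<open>t\<close>
  with the following coefficients.
\<close>

definition pullback_coeff1 :: "(ratfun \<Rightarrow> ratfun) \<Rightarrow> ratfun \<Rightarrow> ratfun" where
  "pullback_coeff1 P R = - deriv_rf (deriv_rf R) / deriv_rf R + deriv_rf R * P R"

definition pullback_coeff0 :: "(ratfun \<Rightarrow> ratfun) \<Rightarrow> ratfun \<Rightarrow> ratfun" where
  "pullback_coeff0 Q R = (deriv_rf R)\<^sup>2 * Q R"

text \<open>
  The hypergeometric equation with parameters \<open>a, b, c\<close> becomes the
  Heun equation on substituting \<open>z = R(t)\<close>.
\<close>

definition heun_reduced_by ::
  "complex \<Rightarrow> complex \<Rightarrow> complex \<Rightarrow> complex \<Rightarrow> complex \<Rightarrow> complex \<Rightarrow> complex \<Rightarrow>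
   complex \<Rightarrow> complex \<Rightarrow> complex \<Rightarrow> ratfun \<Rightarrow> bool" where
  "heun_reduced_by d q \<alpha> \<beta> \<gamma> \<delta> \<epsilon> a b c R \<longleftrightarrow>
     R \<notin> range const_rf \<and>
     pullback_coeff1 (hypergeom_coeff1 a b c) R = heun_coeff1 d \<gamma> \<delta> \<epsilon> \<and>
     pullback_coeff0 (hypergeom_coeff0 a b) R = heun_coeff0 d q \<alpha> \<beta>"

lemma const_rf_add: "const_rf (x + y) = const_rf x + const_rf y"
  using to_fract_add[of "[:x:]" "[:y:]"] by simp

lemma const_rf_diff: "const_rf (x - y) = const_rf x - const_rf y"
  using to_fract_diff[of "[:x:]" "[:y:]"] by simp

lemma const_rf_1: "const_rf 1 = 1"
  by (metis one_pCons to_fract_1)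

lemma pullback_hypergeom_coeff1:
  assumes "R \<notin> range const_rf"
  shows "pullback_coeff1 (hypergeom_coeff1 a b c) R =
    - deriv_rf (deriv_rf R) / deriv_rf R +
    deriv_rf R / (R * (1 - R)) * (const_rf c - const_rf (a + b + 1) * R)"
proof -
  have "const_rf 0 = 0" by simp
  then have "R \<noteq> 0" "R \<noteq> 1"
    using assms const_rf_1 rangeI[of const_rf 0] rangeI[of const_rf 1] by auto
  then have "const_rf c / R + K / (R - 1) = (const_rf c * (1 - R) - K * R) / (R * (1 - R))" for K
    by (simp add: field_simps)
  moreover have "const_rf c * (1 - R) - const_rf (a + b - c + 1) * R =
      const_rf c - const_rf (a + b + 1) * R"
    by (simp only: const_rf_add const_rf_diff const_rf_1) (simp only: algebra_simps, simp)
  ultimately have "const_rf c / R + const_rf (a + b - c + 1) / (R - 1) =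
      (const_rf c - const_rf (a + b + 1) * R) / (R * (1 - R))"
    by metis
  then show ?thesis
    unfolding pullback_coeff1_def hypergeom_coeff1_def by simp
qed

lemma pullback_hypergeom_coeff0:
  "pullback_coeff0 (hypergeom_coeff0 a b) R =
    - (const_rf (a * b) * (deriv_rf R)\<^sup>2 / (R * (1 - R)))"
proof -
  have "R * (R - 1) = - (R * (1 - R))" by (simp add: algebra_simps)
  then show ?thesis
    unfolding pullback_coeff0_def hypergeom_coeff0_def by (simp add: mult.commute)
qed

text \<open>
  The clauses exclude that \<open>0\<close>, \<open>1\<close>, \<open>d\<close>, respectively \<open>\<infinity>\<close>, is an ordinary point.
\<close>

definition heun_four_singular_points ::
  "complex \<Rightarrow> complex \<Rightarrow> complex \<Rightarrow> complex \<Rightarrow> complex \<Rightarrow> complex \<Rightarrow> complex \<Rightarrow> bool" where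
  "heun_four_singular_points d q \<alpha> \<beta> \<gamma> \<delta> \<epsilon> \<longleftrightarrow>
     \<not> (\<gamma> = 0 \<and> q = 0) \<and>
     \<not> (\<delta> = 0 \<and> q = \<alpha> * \<beta>) \<and>
     \<not> (\<epsilon> = 0 \<and> q = \<alpha> * \<beta> * d) \<and>
     \<not> (\<alpha> * \<beta> = 0 \<and> \<alpha> + \<beta> = 1 \<and> q = 0)"

definition heun_trivial :: "complex \<Rightarrow> complex \<Rightarrow> complex \<Rightarrow> bool" where
  "heun_trivial q \<alpha> \<beta> \<longleftrightarrow> \<alpha> * \<beta> = 0 \<and> q = 0"

text \<open>
  An affine map \<open>t \<mapsto> m t + n\<close> with \<open>m \<noteq> 0\<close> is a polynomial \<open>A = [:n, m:]\<close> of degree 1.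
\<close>

definition affine_triangle_map :: "complex poly \<Rightarrow> complex \<Rightarrow> complex \<Rightarrow> bool" where
  "affine_triangle_map A d D \<longleftrightarrow> degree A = 1 \<and> poly A ` {0, 1, d} = {0, 1, D}"

definition similar_triangles :: "complex \<Rightarrow> complex \<Rightarrow> bool" where
  "similar_triangles d D \<longleftrightarrow> (\<exists>A. affine_triangle_map A d D)"

text \<open>The exponent parameter belonging to the finite singular point \<open>t \<in> {0, 1, d}\<close>.\<close>

definition exponent_param :: "complex \<Rightarrow> complex \<Rightarrow> complex \<Rightarrow> complex \<Rightarrow> complex" where
  "exponent_param \<gamma> \<delta> \<epsilon> t = (if t = 0 then \<gamma> else if t = 1 then \<delta> else \<epsilon>)"

text \<open>
  The format shared by all subcases, for given \<open>D\<close>, \<open>p\<^sub>0\<close> and \<open>P\<close>; the predicate \<open>restr\<close> states the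
  restrictions on the exponent parameters in terms of the function \<open>x \<mapsto> \<kappa>\<^sub>x\<close>,
  where \<open>x \<in> {0, 1, D}\<close>. The argument \<open>p\<close> is the normalized accessory parameter.
\<close>

definition reduction_subcase ::
  "complex \<Rightarrow> complex \<Rightarrow> complex \<Rightarrow> complex \<Rightarrow> complex \<Rightarrow> ratfun \<Rightarrow>
   complex \<Rightarrow> complex \<Rightarrow> ((complex \<Rightarrow> complex) \<Rightarrow> bool) \<Rightarrow> complex poly \<Rightarrow> bool" where
  "reduction_subcase d p \<gamma> \<delta> \<epsilon> R D p\<^sub>0 restr P \<longleftrightarrow>
     similar_triangles d D \<and>
     (\<exists>A. affine_triangle_map A d D \<and>
          poly A p = p\<^sub>0 \<and>
          restr (\<lambda>x. exponent_param \<gamma> \<delta> \<epsilon> (inv (poly A) x)) \<and>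
          (R = to_fract (pcompose P A) \<or> 1 - R = to_fract (pcompose P A)))"

end

theory Submission
  imports Defs
begin

text \<open>
  At a pole of \<open>R\<close> the coefficient of \<open>y\<close> in the pulled back equation would have a double pole, which
  the Heun equation does not have; so \<open>R\<close> is a polynomial, of degree \<open>n\<close> say. With \<open>p = q / \<alpha>\<beta>\<close>,
  comparing the coefficients of \<open>y\<close> gives an equation of Pell-Abel type,
  \<open>R'\<^sup>2 t (t - 1) (t - d) = n\<^sup>2 (t - p) R (R - 1)\<close>, and eliminating \<open>R'\<close> from the coefficients of \<open>y'\<close> leaves
  an identity between logarithmic derivatives, that is, a linear condition on the multiplicities of the zeros
  of \<open>R\<close> and \<open>R - 1\<close>.

  By the first equation every zero of \<open>R (R - 1)\<close> outside \<open>{0, 1, d, p}\<close> is double. If both \<open>R\<close> and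
  \<open>R - 1\<close> had such zeros, both constants in the second condition would vanish, which forces one of
  \<open>0, 1, d\<close> to be an ordinary point. Hence \<open>S = R\<close> or \<open>S = 1 - R\<close> has all its zeros in
  \<open>{0, 1, d, p}\<close>, with prescribed multiplicities; it can moreover be chosen to vanish at \<open>p\<close>. This leaves
  seven possible shapes of \<open>S\<close>, according to whether \<open>p\<close> is one of \<open>0, 1, d\<close> and how many of the other points
  are zeros. After an affine normalization, comparing coefficients in the Pell equation determines the
  triangle, \<open>p\<close> and \<open>S\<close> in each case, up to the exchange \<open>t \<mapsto> 1 - t\<close>.
\<close>

section \<open>Logarithmic derivatives\<close>

lemma order_linear_factor: "order a [:-b, 1:] = (if a = b then 1 else 0)" for a b :: complex
  by (auto simp: order_power_n_n[of b 1, simplified] order_0I)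

text \<open>A point of \<open>F\<close> that is not a root contributes a factor with exponent 0.
  Allowing such points makes it possible to expand several polynomials over one common finite
  set.\<close>

lemma complex_poly_prod_order:
  fixes p :: "complex poly"
  assumes "finite F" "\<And>s. poly p s = 0 \<Longrightarrow> s \<in> F" "p \<noteq> 0"
  shows "smult (lead_coeff p) (\<Prod>s\<in>F. [:-s, 1:] ^ order s p) = p"
proof -
  have "(\<Prod>s\<in>F. [:-s, 1:] ^ order s p) = (\<Prod>s | poly p s = 0. [:-s, 1:] ^ order s p)"
    using assms by (intro prod.mono_neutral_right) (auto simp: order_root)
  then show ?thesis by (simp add: complex_poly_decompose)
qed

section \<open>Constants and logarithmic derivatives in the field of fractions\<close>

lemma const_rf_mult: "const_rf (x * y) = const_rf x * const_rf y"
  by (simp flip: to_fract_mult)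

lemma const_rf_0: "const_rf 0 = 0"
  by simp

lemma const_rf_minus: "const_rf (- x) = - const_rf x"
  by (simp flip: to_fract_uminus)

lemma to_fract_smult: "to_fract (smult c p) = const_rf c * to_fract p"
  by (simp flip: to_fract_mult)

lemma to_fract_power: "to_fract (p ^ n) = to_fract p ^ n"
  by (induction n) auto

definition dlog :: "complex poly \<Rightarrow> ratfun" where
  "dlog f = to_fract (pderiv f) / to_fract f"

lemma dlog_mult: "f \<noteq> 0 \<Longrightarrow> g \<noteq> 0 \<Longrightarrow> dlog (f * g) = dlog f + dlog g"
  by (simp add: dlog_def pderiv_mult add_divide_distrib)

lemma dlog_1 [simp]: "dlog 1 = 0"
  by (simp add: dlog_def)

lemma dlog_smult: "c \<noteq> 0 \<Longrightarrow> dlog (smult c f) = dlog f"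
  by (simp add: dlog_def pderiv_smult to_fract_smult)

lemma dlog_power: "f \<noteq> 0 \<Longrightarrow> dlog (f ^ n) = const_rf (of_nat n) * dlog f"
proof (induction n)
  case (Suc n)
  have "const_rf (of_nat (Suc n)) = 1 + const_rf (of_nat n)"
    by (simp only: of_nat_Suc const_rf_add const_rf_1)
  then show ?case using Suc by (simp add: dlog_mult algebra_simps)
qed simp

lemma dlog_prod: "finite F \<Longrightarrow> (\<And>i. i \<in> F \<Longrightarrow> f i \<noteq> 0) \<Longrightarrow> dlog (\<Prod>i\<in>F. f i) = (\<Sum>i\<in>F. dlog (f i))"
  by (induction F rule: finite_induct) (auto simp: dlog_mult)

lemma dlog_expand:
  assumes "finite F" "\<And>s. poly p s = 0 \<Longrightarrow> s \<in> F" "p \<noteq> 0"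
  shows "dlog p = (\<Sum>s\<in>F. const_rf (of_nat (order s p)) * dlog [:-s, 1:])"
proof -
  have "dlog p = dlog (smult (lead_coeff p) (\<Prod>s\<in>F. [:-s, 1:] ^ order s p))"
    using complex_poly_prod_order[OF assms] by simp
  also have "\<dots> = (\<Sum>s\<in>F. dlog ([:-s, 1:] ^ order s p))"
    using assms by (simp add: dlog_smult dlog_prod)
  also have "\<dots> = (\<Sum>s\<in>F. const_rf (of_nat (order s p)) * dlog [:-s, 1:])"
    by (intro sum.cong refl dlog_power) auto
  finally show ?thesis .
qed

text \<open>After multiplication by the common denominator \<open>T\<close>, evaluation at
  \<open>u\<close> kills every summand except the one with \<open>s = u\<close>, whose remaining
  product does not vanish there.\<close>

lemma simple_poles_independent:
  assumes "finite F" "(\<Sum>s\<in>F. const_rf (a s) * dlog [:-s, 1:]) = 0" "u \<in> F"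
  shows "a u = 0"
proof -
  define T where "T = (\<Prod>s\<in>F. [:-s, 1:])"
  have T: "T = [:-s, 1:] * (\<Prod>x\<in>F - {s}. [:-x, 1:])" if "s \<in> F" for s
    unfolding T_def using assms(1) that by (rule prod.remove)
  have pole: "const_rf (a s) * dlog [:-s, 1:] * to_fract T =
      to_fract (smult (a s) (\<Prod>x\<in>F - {s}. [:-x, 1:]))" if "s \<in> F" for s
    unfolding T[OF that] to_fract_smult to_fract_mult dlog_def
    by (simp add: pderiv_pCons const_rf_1 del: mult_pCons_left to_fract_diff)
  have "to_fract (\<Sum>s\<in>F. smult (a s) (\<Prod>x\<in>F - {s}. [:-x, 1:])) =
      (\<Sum>s\<in>F. const_rf (a s) * dlog [:-s, 1:]) * to_fract T"
    by (simp add: pole sum_distrib_right)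
  then have 0: "(\<Sum>s\<in>F. smult (a s) (\<Prod>x\<in>F - {s}. [:-x, 1:])) = 0"
    unfolding assms(2) mult_zero_left to_fract_eq_0_iff .
  have "0 = poly (\<Sum>s\<in>F. smult (a s) (\<Prod>x\<in>F - {s}. [:-x, 1:])) u"
    by (simp add: 0)
  also have "\<dots> = (\<Sum>s\<in>F. a s * (\<Prod>x\<in>F - {s}. u - x))"
    by (simp add: poly_sum poly_prod)
  also have "\<dots> = (\<Sum>s\<in>{u}. a s * (\<Prod>x\<in>F - {s}. u - x))"
    using assms by (intro sum.mono_neutral_right) auto
  finally show ?thesis using assms(1) by simp
qed

text \<open>The inner sum on the right is the residue at \<open>s\<close> of the sum on the left,
  which has only simple poles and no polynomial part. So an identity between logarithmic derivatives
  amounts to one linear condition on multiplicities at each point.\<close>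

lemma sum_dlog_eq_0_iff:
  assumes "\<And>c f. (c, f) \<in> set xs \<Longrightarrow> f \<noteq> 0"
  shows "(\<Sum>(c, f)\<leftarrow>xs. const_rf c * dlog f) = 0 \<longleftrightarrow> (\<forall>s. (\<Sum>(c, f)\<leftarrow>xs. c * of_nat (order s f)) = 0)"
proof -
  define F where "F = (\<Union>(c, f)\<in>set xs. {s. poly f s = 0})"
  have fin: "finite F"
    unfolding F_def using assms by (auto simp: poly_roots_finite)
  define g where "g s = (\<Sum>(c, f)\<leftarrow>xs. c * of_nat (order s f))" for s
  \<comment> \<open>The induction runs over lists \<open>ys\<close> with entries from
    \<open>xs\<close>, so that the set \<open>F\<close> of all roots stays fixed.\<close>
  have "(\<Sum>(c, f)\<leftarrow>ys. const_rf c * dlog f) =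
      (\<Sum>s\<in>F. const_rf (\<Sum>(c, f)\<leftarrow>ys. c * of_nat (order s f)) * dlog [:-s, 1:])"
    if "set ys \<subseteq> set xs" for ys
    using that
  proof (induction ys)
    case (Cons y ys)
    obtain c f where y: "y = (c, f)" by force
    have "f \<noteq> 0" "\<And>s. poly f s = 0 \<Longrightarrow> s \<in> F"
      using assms Cons.prems y by (auto simp: F_def)
    note e = dlog_expand[OF fin this(2,1)]
    show ?case
      using Cons by (simp add: y e const_rf_add const_rf_mult distrib_right sum.distrib sum_distrib_left mult.assoc
          del: to_fract_add mult_pCons_left to_fract_mult)
  qed simp
  then have e: "(\<Sum>(c, f)\<leftarrow>xs. const_rf c * dlog f) =
      (\<Sum>s\<in>F. const_rf (g s) * dlog [:-s, 1:])"
    unfolding g_def by blast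
  \<comment> \<open>Outside \<open>F\<close> all orders vanish, which allows the quantifier in the
    claim to range over all points.\<close>
  have out: "g s = 0" if "s \<notin> F" for s
  proof -
    have "c * of_nat (order s f) = 0" if "(c, f) \<in> set xs" for c f
      using \<open>s \<notin> F\<close> that by (auto simp: F_def order_root)
    then have "map (\<lambda>(c, f). c * of_nat (order s f)) xs = map (\<lambda>_. 0) xs"
      by (intro map_cong) auto
    then show ?thesis by (simp only: g_def sum_list_0)
  qed
  have "(\<Sum>s\<in>F. const_rf (g s) * dlog [:-s, 1:]) = 0 \<longleftrightarrow> (\<forall>s. g s = 0)"
  proof
    assume "(\<Sum>s\<in>F. const_rf (g s) * dlog [:-s, 1:]) = 0"
    from simple_poles_independent[OF fin this] out show "\<forall>s. g s = 0" by blast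
  qed simp
  then show ?thesis unfolding e g_def .
qed

section \<open>The pulled back equation\<close>

text \<open>
  In \<open>pell\<close>, \<open>E\<close> is the set of finite singular points and \<open>p\<close> the normalized accessory parameter.
  In \<open>balanced\<close>, \<open>C\<close> and \<open>C'\<close> stand for \<open>c - 1/2\<close> and \<open>a + b - c + 1/2\<close>; the values of \<open>\<kappa>\<close> outside \<open>E\<close>
  are irrelevant.
\<close>

definition pell :: "complex set \<Rightarrow> complex \<Rightarrow> complex poly \<Rightarrow> bool" where
  "pell E p r \<longleftrightarrow> 0 < degree r \<and>
     (pderiv r)\<^sup>2 * (\<Prod>x\<in>E. [:-x, 1:]) = smult ((of_nat (degree r))\<^sup>2) ([:-p, 1:] * (r * (r - 1)))"

definition balanced :: "complex set \<Rightarrow> (complex \<Rightarrow> complex) \<Rightarrow> complex \<Rightarrow> complex poly \<Rightarrow> complex \<Rightarrow> complex \<Rightarrow> bool" where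
  "balanced E \<kappa> p r C C' \<longleftrightarrow> (\<forall>s. C * of_nat (order s r) + C' * of_nat (order s (r - 1)) =
     of_bool (s \<in> E) * (\<kappa> s - 1/2) + of_bool (s = p) / 2)"

text \<open>No condition on \<open>a * b\<close> appears: \<open>C\<close> and \<open>C'\<close> fix
  only \<open>c\<close> and \<open>a + b\<close>, and \<open>a * b\<close> can be adjusted to
  \<open>\<alpha> * \<beta>\<close> afterwards.\<close>

definition reducing :: "complex set \<Rightarrow> (complex \<Rightarrow> complex) \<Rightarrow> complex \<Rightarrow> complex poly \<Rightarrow> bool" where
  "reducing E \<kappa> p r \<longleftrightarrow> pell E p r \<and> (\<exists>C C'. balanced E \<kappa> p r C C')"

lemma order_prod_linear:
  fixes s :: complex
  assumes "finite E"
  shows "order s (\<Prod>x\<in>E. [:-x, 1:]) = of_bool (s \<in> E)"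
  using assms
proof (induction E rule: finite_induct)
  case (insert x E)
  then have "[:-x, 1:] * (\<Prod>x\<in>E. [:-x, 1:]) \<noteq> 0"
    by (simp only: mult_eq_0_iff) auto
  then show ?case using insert by (auto simp: order_mult order_linear_factor simp del: mult_pCons_left)
qed auto

lemma nonconstant_nonzero:
  fixes r :: "complex poly"
  assumes "0 < degree r"
  shows "r \<noteq> 0" "r - 1 \<noteq> 0" "pderiv r \<noteq> 0"
  using assms by (auto simp: pderiv_eq_0_iff)

text \<open>Both sides of the Pell equation have the same order at \<open>s\<close>; the constant on
  the right is nonzero because \<open>r\<close> is not constant.\<close>

lemma pell_order:
  assumes "finite E" "pell E p r"
  shows "2 * order s (pderiv r) + of_bool (s \<in> E) = of_bool (s = p) + order s r + order s (r - 1)"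
proof -
  have n: "0 < degree r" and eq: "(pderiv r)\<^sup>2 * (\<Prod>x\<in>E. [:-x, 1:]) =
      smult ((of_nat (degree r))\<^sup>2) ([:-p, 1:] * (r * (r - 1)))"
    using assms by (auto simp: pell_def)
  note nz = nonconstant_nonzero[OF n]
  have T: "(\<Prod>x\<in>E. [:-x, 1:]) \<noteq> 0" using assms by auto
  have "order s ((pderiv r)\<^sup>2 * (\<Prod>x\<in>E. [:-x, 1:])) = 2 * order s (pderiv r) + of_bool (s \<in> E)"
    using nz T assms(1) by (simp add: order_mult power2_eq_square order_prod_linear)
  moreover have "order s (smult ((of_nat (degree r))\<^sup>2) ([:-p, 1:] * (r * (r - 1)))) =
      of_bool (s = p) + order s r + order s (r - 1)"
    using nz n by (simp add: order_smult order_mult order_linear_factor del: mult_pCons_left)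
  ultimately show ?thesis using eq by simp
qed

section \<open>Comparison with the coefficients of the Heun equation\<close>

lemma deriv_rf_to_fract: "deriv_rf (to_fract r) = to_fract (pderiv r)"
  using deriv_rf_Fract[of 1 r] by (simp add: to_fract_def)

lemma prod_singular_points:
  assumes "d \<noteq> 0" "d \<noteq> 1"
  shows "var_rf * (var_rf - 1) * (var_rf - const_rf d) = to_fract (\<Prod>x\<in>{0, 1, d}. [:-x, 1:])"
proof -
  have lin: "to_fract [:-x, 1:] = var_rf - const_rf x" for x
    by (simp flip: to_fract_diff)
  have "(\<Prod>x\<in>{0, 1, d}. [:-x, 1:]) = [:-0, 1:] * ([:-1, 1:] * [:-d, 1:])"
    using assms by (simp del: mult_pCons_left mult_pCons_right)
  then show ?thesis
    by (simp only: to_fract_mult lin const_rf_0 const_rf_1 diff_0_right mult.assoc)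
qed

text \<open>Write \<open>R = u / v\<close> in lowest terms and clear denominators. At a zero of
  \<open>v\<close> of order \<open>m\<close>, the side carrying \<open>v^2\<close> has order at
  least \<open>2 * m\<close>. The numerator \<open>W\<close> of the derivative has order below
  \<open>m\<close> there and \<open>T\<close> has only simple zeros, so the other side has order at
  most \<open>2 * m - 1\<close>. Hence \<open>v\<close> has no zeros.\<close>

lemma pole_free_pullback:
  assumes "R \<notin> range const_rf" "[:-q, \<alpha> * \<beta>:] \<noteq> 0" "d \<noteq> 0" "d \<noteq> 1"
    and eq: "pullback_coeff0 (hypergeom_coeff0 a b) R = heun_coeff0 d q \<alpha> \<beta>"
  shows "R \<in> range to_fract"
proof -
  obtain u v where uv: "quot_of_fract R = (u, v)" by fastforce
  have v: "v \<noteq> 0" using snd_quot_of_fract_nonzero[of R] uv by simp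
  have cop: "coprime u v" using coprime_quot_of_fract[of R] uv by simp
  have R: "R = Fract u v"
    using quot_to_fract_quot_of_fract[of R] uv by (simp add: quot_to_fract_def)
  define W where "W = pderiv u * v - u * pderiv v"
  define T where "T = (\<Prod>x\<in>{0, 1, d}. [:-x, 1:])"
  have T0: "T \<noteq> 0" by (simp add: T_def)
  have T: "var_rf * (var_rf - 1) * (var_rf - const_rf d) = to_fract T"
    unfolding T_def by (rule prod_singular_points[OF assms(3,4)])
  have L: "const_rf (\<alpha> * \<beta>) * var_rf - const_rf q = to_fract [:-q, \<alpha> * \<beta>:]"
    by (simp flip: to_fract_diff to_fract_mult)
  have "R \<noteq> 0" "R \<noteq> 1"
    using assms(1) const_rf_1 const_rf_0 by (metis rangeI)+
  then have u: "u \<noteq> 0" "u \<noteq> v"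
    using R v by (auto simp: Fract_conv_to_fract)
  have R1: "R - 1 = to_fract (u - v) / to_fract v"
    using v by (simp add: R Fract_conv_to_fract field_simps)
  have dR: "deriv_rf R = to_fract W / (to_fract v)\<^sup>2"
    using deriv_rf_Fract[OF v] by (simp add: R W_def Fract_conv_to_fract to_fract_power)
  have "to_fract (smult (a * b) (W\<^sup>2 * T)) = to_fract ([:-q, \<alpha> * \<beta>:] * (u * (u - v) * v\<^sup>2))"
  proof -
    have "(to_fract W / (to_fract v)\<^sup>2)\<^sup>2 * (const_rf (a * b) / (to_fract u / to_fract v * (to_fract (u - v) / to_fract v)))
      = to_fract [:-q, \<alpha> * \<beta>:] / to_fract T"
      using eq unfolding pullback_coeff0_def hypergeom_coeff0_def heun_coeff0_def dR R1 T L
      by (simp add: R Fract_conv_to_fract)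
    moreover have "to_fract u \<noteq> 0" "to_fract v \<noteq> 0" "to_fract (u - v) \<noteq> 0" "to_fract T \<noteq> 0"
      using u v T0 by (auto simp del: to_fract_diff)
    ultimately have "const_rf (a * b) * ((to_fract W)\<^sup>2 * to_fract T) =
        to_fract [:-q, \<alpha> * \<beta>:] * (to_fract u * to_fract (u - v) * (to_fract v)\<^sup>2)"
      by (simp add: field_simps power2_eq_square del: to_fract_diff)
    then show ?thesis
      by (simp only: to_fract_smult to_fract_mult to_fract_power)
  qed
  then have id: "smult (a * b) (W\<^sup>2 * T) = [:-q, \<alpha> * \<beta>:] * (u * (u - v) * v\<^sup>2)"
    by (simp only: to_fract_eq_iff)
  \<comment> \<open>Since this side is nonzero, \<open>a * b\<close> and \<open>W\<close> are
    nonzero as well, and orders can be compared.\<close>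
  have rhs0: "[:-q, \<alpha> * \<beta>:] * (u * (u - v) * v\<^sup>2) \<noteq> 0"
    using u v assms(2) by (simp only: mult_eq_0_iff power_eq_0_iff) auto
  then have ab: "a * b \<noteq> 0" and W0: "W \<noteq> 0" using id by (metis smult_0_left, auto)
  have "degree v = 0"
  proof (rule ccontr)
    assume dv: "degree v \<noteq> 0"
    then obtain s where s: "poly v s = 0"
      by (metis alg_closed_imp_poly_has_root neq0_conv)
    define m where "m = order s v"
    have m: "m \<noteq> 0" using s v by (simp add: m_def order_root)
    have dv0: "pderiv v \<noteq> 0" using dv by (simp add: pderiv_eq_0_iff)
    have us: "poly u s \<noteq> 0"
      using cop s by (metis coprime_poly_0 )
    have dvdv: "[:-s, 1:] ^ m dvd v" unfolding m_def by (rule order_1)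
    \<comment> \<open>Otherwise this power would divide \<open>u * pderiv v\<close>, whose order at
      \<open>s\<close> is only \<open>m - 1\<close> because \<open>u\<close> does not vanish at
      \<open>s\<close>.\<close>
    have "\<not> [:-s, 1:] ^ m dvd W"
    proof
      assume "[:-s, 1:] ^ m dvd W"
      then have "[:-s, 1:] ^ m dvd pderiv u * v - W" using dvdv by (intro dvd_diff dvd_mult)
      then have "[:-s, 1:] ^ m dvd u * pderiv v" by (simp add: W_def)
      then have "m \<le> order s (u * pderiv v)" using u dv0 by (simp add: order_divides)
      also have "\<dots> = order s (pderiv v)"
        using u dv0 us by (simp add: order_mult order_0I)
      finally show False
        using order_pderiv[OF v s] by (simp add: m_def)
    qed
    then have Wm: "order s W < m" using W0 by (simp add: order_divides)
    have "2 * order s W + 1 \<ge> order s (smult (a * b) (W\<^sup>2 * T))"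
      using W0 T0 ab by (simp add: order_smult order_mult power2_eq_square T_def order_prod_linear)
    moreover have "order s (smult (a * b) (W\<^sup>2 * T)) \<ge> 2 * m"
    proof -
      have "[:-s, 1:] ^ (2 * m) dvd v\<^sup>2"
        using dvdv by (metis dvd_power_same mult.commute power_mult)
      then have "[:-s, 1:] ^ (2 * m) dvd smult (a * b) (W\<^sup>2 * T)"
        unfolding id by (intro dvd_mult)
      moreover have "smult (a * b) (W\<^sup>2 * T) \<noteq> 0" using rhs0 id by simp
      ultimately show ?thesis by (simp only: order_divides) auto
    qed
    ultimately show False using Wm by simp
  qed
  then obtain k where k: "v = [:k:]" by (metis degree_eq_zeroE)
  have "R = to_fract (smult (1 / k) u)"
    using v k unfolding R to_fract_def by (simp add: eq_fract)
  then show ?thesis by blast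
qed

lemma nonconstant_to_fract: "to_fract r \<notin> range const_rf \<longleftrightarrow> 0 < degree r"
proof -
  have "to_fract r \<in> range const_rf \<longleftrightarrow> (\<exists>k. r = [:k:])"
    unfolding image_iff to_fract_eq_iff by simp
  also have "\<dots> \<longleftrightarrow> degree r = 0"
    by (metis degree_eq_zeroE degree_pCons_0)
  finally show ?thesis by simp
qed

text \<open>Clearing denominators leaves a polynomial identity whose left side has degree
  \<open>2 * degree r + 1\<close>. Comparing degrees shows that the numerator of the Heun
  coefficient is really linear, that is, \<open>\<alpha> * \<beta> \<noteq> 0\<close>. Comparing
  leading coefficients gives the second conjunct. Division by \<open>a * b\<close> then leaves the
  Pell equation.\<close>

lemma pullback0_iff:
  assumes "0 < degree r" "d \<noteq> 0" "d \<noteq> 1" "[:-q, \<alpha> * \<beta>:] \<noteq> 0"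
  shows "pullback_coeff0 (hypergeom_coeff0 a b) (to_fract r) = heun_coeff0 d q \<alpha> \<beta> \<longleftrightarrow>
    \<alpha> * \<beta> \<noteq> 0 \<and> a * b * (of_nat (degree r))\<^sup>2 = \<alpha> * \<beta> \<and> pell {0, 1, d} (q / (\<alpha> * \<beta>)) r"
proof -
  define T where "T = (\<Prod>x\<in>{0, 1, d}. [:-x, 1:])"
  note nz = nonconstant_nonzero[OF assms(1)]
  have T0: "T \<noteq> 0" by (simp add: T_def)
  have T3: "T = [:0, 1:] * [:-1, 1:] * [:-d, 1:]"
    unfolding T_def using assms(2,3) by simp
  have T_deg: "degree T = 3" "lead_coeff T = 1"
    unfolding T3 by (auto simp: numeral_3_eq_3)
  have L: "const_rf (\<alpha> * \<beta>) * var_rf - const_rf q = to_fract [:-q, \<alpha> * \<beta>:]"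
    by (simp flip: to_fract_diff to_fract_mult)
  have "pullback_coeff0 (hypergeom_coeff0 a b) (to_fract r) = heun_coeff0 d q \<alpha> \<beta> \<longleftrightarrow>
      (to_fract (pderiv r))\<^sup>2 * (const_rf (a * b) / (to_fract r * to_fract (r - 1))) =
      to_fract [:-q, \<alpha> * \<beta>:] / to_fract T"
    unfolding pullback_coeff0_def hypergeom_coeff0_def heun_coeff0_def
      prod_singular_points[OF assms(2,3), folded T_def] L
    by (simp add: deriv_rf_to_fract)
  also have "\<dots> \<longleftrightarrow> const_rf (a * b) * ((to_fract (pderiv r))\<^sup>2 * to_fract T) =
      to_fract [:-q, \<alpha> * \<beta>:] * (to_fract r * to_fract (r - 1))"
  proof -
    have "to_fract r \<noteq> 0" "to_fract (r - 1) \<noteq> 0" "to_fract T \<noteq> 0"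
      using nz T0 by (auto simp del: to_fract_diff)
    then show ?thesis by (simp add: field_simps power2_eq_square del: to_fract_diff)
  qed
  also have "\<dots> \<longleftrightarrow> smult (a * b) ((pderiv r)\<^sup>2 * T) = [:-q, \<alpha> * \<beta>:] * (r * (r - 1))"
  proof -
    have "const_rf (a * b) * ((to_fract (pderiv r))\<^sup>2 * to_fract T) = to_fract (smult (a * b) ((pderiv r)\<^sup>2 * T))"
      by (simp only: to_fract_smult to_fract_mult to_fract_power)
    moreover have "to_fract [:-q, \<alpha> * \<beta>:] * (to_fract r * to_fract (r - 1)) =
        to_fract ([:-q, \<alpha> * \<beta>:] * (r * (r - 1)))"
      by (simp only: to_fract_mult)
    ultimately show ?thesis by (simp only: to_fract_eq_iff)
  qed
  finally have iff1: "pullback_coeff0 (hypergeom_coeff0 a b) (to_fract r) = heun_coeff0 d q \<alpha> \<beta> \<longleftrightarrow>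
      smult (a * b) ((pderiv r)\<^sup>2 * T) = [:-q, \<alpha> * \<beta>:] * (r * (r - 1))" .
  have deg_r1: "degree (r - 1) = degree r" "lead_coeff (r - 1) = lead_coeff r"
  proof -
    have "degree (r + (- 1)) = degree r" using assms(1) by (intro degree_add_eq_left) simp
    then show "degree (r - 1) = degree r" by simp
    then show "lead_coeff (r - 1) = lead_coeff r"
      using assms(1) by (cases "degree r") auto
  qed
  have lc_dr: "lead_coeff (pderiv r) = of_nat (degree r) * lead_coeff r"
    using assms(1) by (cases "degree r") (auto simp: degree_pderiv coeff_pderiv)
  have "\<alpha> * \<beta> \<noteq> 0 \<and> a * b * (of_nat (degree r))\<^sup>2 = \<alpha> * \<beta>"
    if eq: "smult (a * b) ((pderiv r)\<^sup>2 * T) = [:-q, \<alpha> * \<beta>:] * (r * (r - 1))"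
  proof
    have "[:-q, \<alpha> * \<beta>:] * (r * (r - 1)) \<noteq> 0"
      using nz assms(4) by (simp only: mult_eq_0_iff) auto
    then have ab: "a * b \<noteq> 0" using eq by (metis smult_0_left)
    have "degree (smult (a * b) ((pderiv r)\<^sup>2 * T)) = 2 * (degree r - 1) + 3"
      using ab nz T0 by (simp add: degree_mult_eq degree_power_eq degree_pderiv T_deg)
    also have "\<dots> = 2 * degree r + 1" using assms(1) by simp
    finally have "degree ([:-q, \<alpha> * \<beta>:] * (r * (r - 1))) = 2 * degree r + 1"
      unfolding eq .
    moreover have "degree ([:-q, \<alpha> * \<beta>:] * (r * (r - 1))) = degree [:-q, \<alpha> * \<beta>:] + (degree r + degree r)"
      using nz assms(4) degree_mult_eq[of r "r - 1"] degree_mult_eq[of "[:-q, \<alpha> * \<beta>:]" "r * (r - 1)"] deg_r1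
      by (metis mult_eq_0_iff)
    ultimately have "degree [:-q, \<alpha> * \<beta>:] = 1" by linarith
    then show "\<alpha> * \<beta> \<noteq> 0" by (auto split: if_splits)
    have "lead_coeff (smult (a * b) ((pderiv r)\<^sup>2 * T)) = a * b * (of_nat (degree r) * lead_coeff r)\<^sup>2"
      by (simp only: lead_coeff_smult lead_coeff_mult lead_coeff_power lc_dr T_deg(2) mult_1_right)
    moreover have "lead_coeff [:-q, \<alpha> * \<beta>:] = \<alpha> * \<beta>"
      using \<open>\<alpha> * \<beta> \<noteq> 0\<close> by simp
    then have "lead_coeff ([:-q, \<alpha> * \<beta>:] * (r * (r - 1))) = \<alpha> * \<beta> * (lead_coeff r)\<^sup>2"
      by (simp only: lead_coeff_mult deg_r1(2) power2_eq_square)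
    ultimately have "(a * b * (of_nat (degree r))\<^sup>2) * (lead_coeff r)\<^sup>2 = (\<alpha> * \<beta>) * (lead_coeff r)\<^sup>2"
      unfolding eq by (simp only: power_mult_distrib mult.assoc)
    then show "a * b * (of_nat (degree r))\<^sup>2 = \<alpha> * \<beta>"
      using nz(1) by simp
  qed
  moreover have "smult (a * b) ((pderiv r)\<^sup>2 * T) = [:-q, \<alpha> * \<beta>:] * (r * (r - 1)) \<longleftrightarrow>
      pell {0, 1, d} (q / (\<alpha> * \<beta>)) r"
    if ab: "\<alpha> * \<beta> \<noteq> 0" "a * b * (of_nat (degree r))\<^sup>2 = \<alpha> * \<beta>"
  proof -
    have ab0: "a * b \<noteq> 0" using ab by auto
    have "[:-q, \<alpha> * \<beta>:] = smult (a * b) (smult ((of_nat (degree r))\<^sup>2) [:-(q / (\<alpha> * \<beta>)), 1:])"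
      unfolding smult_smult ab(2) using ab(1) by simp
    then have "[:-q, \<alpha> * \<beta>:] * (r * (r - 1)) =
        smult (a * b) (smult ((of_nat (degree r))\<^sup>2) ([:-(q / (\<alpha> * \<beta>)), 1:] * (r * (r - 1))))"
      by (simp only: mult_smult_left)
    then show ?thesis
      unfolding pell_def T_def[symmetric] using ab0 assms(1)
      by (metis smult_cancel)
  qed
  ultimately show ?thesis unfolding iff1 by blast
qed

text \<open>Every term is a multiple of a logarithmic derivative: \<open>R'' / R'\<close> is
  \<open>dlog (pderiv r)\<close>, and the hypergeometric coefficient contributes multiples of
  \<open>dlog r\<close> and \<open>dlog (r - 1)\<close>. The condition on the right compares the
  residues.\<close>

lemma pullback1_iff:
  assumes "0 < degree r" "d \<noteq> 0" "d \<noteq> 1"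
  shows "pullback_coeff1 (hypergeom_coeff1 a b c) (to_fract r) = heun_coeff1 d \<gamma> \<delta> \<epsilon> \<longleftrightarrow>
    (\<forall>s. c * of_nat (order s r) + (a + b - c + 1) * of_nat (order s (r - 1)) - of_nat (order s (pderiv r)) =
      of_bool (s \<in> {0, 1, d}) * exponent_param \<gamma> \<delta> \<epsilon> s)"
proof -
  define e where "e = a + b - c + 1"
  note nz = nonconstant_nonzero[OF assms(1)]
  define xs where "xs = [(-1, pderiv r), (c, r), (e, r - 1), (-\<gamma>, [:0, 1:]), (-\<delta>, [:-1, 1:]), (-\<epsilon>, [:-d, 1:])]"
  have lin: "dlog [:-x, 1:] = 1 / (var_rf - const_rf x)" for x
    by (simp add: dlog_def pderiv_pCons const_rf_1 flip: to_fract_diff)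
  have lins: "dlog [:0, 1:] = 1 / var_rf" "dlog [:-1, 1:] = 1 / (var_rf - 1)"
    using lin[of 0] lin[of 1] const_rf_1 by simp_all
  have "pullback_coeff1 (hypergeom_coeff1 a b c) (to_fract r) = heun_coeff1 d \<gamma> \<delta> \<epsilon> \<longleftrightarrow>
      - dlog (pderiv r) + const_rf c * dlog r + const_rf e * dlog (r - 1) =
      const_rf \<gamma> * dlog [:0, 1:] + const_rf \<delta> * dlog [:-1, 1:] + const_rf \<epsilon> * dlog [:-d, 1:]"
    unfolding pullback_coeff1_def hypergeom_coeff1_def heun_coeff1_def lin lins e_def[symmetric]
    by (simp add: deriv_rf_to_fract dlog_def pderiv_diff const_rf_1 algebra_simps)
  also have "\<dots> \<longleftrightarrow> (\<Sum>(c, f)\<leftarrow>xs. const_rf c * dlog f) = 0"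
    unfolding xs_def by (simp add: const_rf_minus const_rf_1 del: to_fract_uminus) (simp add: algebra_simps)
  also have "\<dots> \<longleftrightarrow> (\<forall>s. (\<Sum>(c, f)\<leftarrow>xs. c * of_nat (order s f)) = 0)"
    using nz by (intro sum_dlog_eq_0_iff) (auto simp: xs_def)
  also have "\<dots> \<longleftrightarrow> (\<forall>s. c * of_nat (order s r) + e * of_nat (order s (r - 1)) - of_nat (order s (pderiv r)) =
      of_bool (s \<in> {0, 1, d}) * exponent_param \<gamma> \<delta> \<epsilon> s)"
  proof (intro all_cong1)
    fix s
    show "(\<Sum>(c, f)\<leftarrow>xs. c * of_nat (order s f)) = 0 \<longleftrightarrow>
        c * of_nat (order s r) + e * of_nat (order s (r - 1)) - of_nat (order s (pderiv r)) =
        of_bool (s \<in> {0, 1, d}) * exponent_param \<gamma> \<delta> \<epsilon> s"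
      unfolding xs_def using assms(2,3) order_linear_factor[of s 0] order_linear_factor[of s 1]
      by (auto simp: order_linear_factor exponent_param_def algebra_simps)
  qed
  finally show ?thesis unfolding e_def .
qed

text \<open>The Pell equation expresses the order of \<open>pderiv r\<close> by those of
  \<open>r\<close> and \<open>r - 1\<close>. Substituting this shifts both constants and the
  exponent parameters by 1/2 and leaves the extra 1/2 at \<open>p\<close>.\<close>

lemma pell_balanced_iff:
  assumes "finite E" "pell E p r"
  shows "(\<forall>s. c * of_nat (order s r) + e * of_nat (order s (r - 1)) - of_nat (order s (pderiv r)) =
      of_bool (s \<in> E) * \<kappa> s) \<longleftrightarrow> balanced E \<kappa> p r (c - 1/2) (e - 1/2)"
  unfolding balanced_def
proof (intro all_cong1)
  fix s
  have "(of_nat (2 * order s (pderiv r) + of_bool (s \<in> E)) :: complex) =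
      of_nat (of_bool (s = p) + order s r + order s (r - 1))"
    by (simp only: pell_order[OF assms])
  then have "(of_nat (order s (pderiv r)) :: complex) =
      (of_bool (s = p) + of_nat (order s r) + of_nat (order s (r - 1)) - of_bool (s \<in> E)) / 2"
    by (simp add: field_simps)
  then have "c * of_nat (order s r) + e * of_nat (order s (r - 1)) - of_nat (order s (pderiv r)) -
      of_bool (s \<in> E) * \<kappa> s =
      (c - 1/2) * of_nat (order s r) + (e - 1/2) * of_nat (order s (r - 1)) -
      (of_bool (s \<in> E) * (\<kappa> s - 1/2) + of_bool (s = p) / 2)"
    by (simp only:) (simp add: field_simps)
  then show "c * of_nat (order s r) + e * of_nat (order s (r - 1)) - of_nat (order s (pderiv r)) =
      of_bool (s \<in> E) * \<kappa> s \<longleftrightarrow>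
      (c - 1/2) * of_nat (order s r) + (e - 1/2) * of_nat (order s (r - 1)) =
      of_bool (s \<in> E) * (\<kappa> s - 1/2) + of_bool (s = p) / 2"
    by (rule diff_eq_diff_eq)
qed

text \<open>The balance condition prescribes \<open>c\<close> and \<open>a + b\<close>, and the
  coefficient of \<open>y\<close> prescribes \<open>a * b\<close>. Complex numbers \<open>a\<close>
  and \<open>b\<close> with given sum and product always exist.\<close>

lemma heun_reduced_by_to_fract_iff:
  assumes "d \<noteq> 0" "d \<noteq> 1" "[:-q, \<alpha> * \<beta>:] \<noteq> 0"
  shows "(\<exists>a b c. heun_reduced_by d q \<alpha> \<beta> \<gamma> \<delta> \<epsilon> a b c (to_fract r)) \<longleftrightarrow>
    \<alpha> * \<beta> \<noteq> 0 \<and> reducing {0, 1, d} (exponent_param \<gamma> \<delta> \<epsilon>) (q / (\<alpha> * \<beta>)) r"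
proof -
  let ?E = "{0, 1, d}" and ?\<kappa> = "exponent_param \<gamma> \<delta> \<epsilon>" and ?p = "q / (\<alpha> * \<beta>)"
  have key: "heun_reduced_by d q \<alpha> \<beta> \<gamma> \<delta> \<epsilon> a b c (to_fract r) \<longleftrightarrow>
      \<alpha> * \<beta> \<noteq> 0 \<and> a * b * (of_nat (degree r))\<^sup>2 = \<alpha> * \<beta> \<and> pell ?E ?p r \<and>
      balanced ?E ?\<kappa> ?p r (c - 1/2) (a + b - c + 1/2)" for a b c
  proof (cases "0 < degree r \<and> pell ?E ?p r")
    case False
    then show ?thesis
      using pullback0_iff[OF _ assms] by (auto simp: heun_reduced_by_def nonconstant_to_fract pell_def)
  next
    case True
    then have n: "0 < degree r" and pell: "pell ?E ?p r" by auto
    have "pullback_coeff1 (hypergeom_coeff1 a b c) (to_fract r) = heun_coeff1 d \<gamma> \<delta> \<epsilon> \<longleftrightarrow>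
        balanced ?E ?\<kappa> ?p r (c - 1/2) (a + b - c + 1 - 1/2)"
      unfolding pullback1_iff[OF n assms(1,2)] by (rule pell_balanced_iff[OF _ pell]) simp
    moreover have "a + b - c + 1 - 1/2 = a + b - c + 1/2" by simp
    ultimately have "pullback_coeff1 (hypergeom_coeff1 a b c) (to_fract r) = heun_coeff1 d \<gamma> \<delta> \<epsilon> \<longleftrightarrow>
        balanced ?E ?\<kappa> ?p r (c - 1/2) (a + b - c + 1/2)"
      by (simp only:)
    then show ?thesis
      using pullback0_iff[OF n assms] pell n by (auto simp: heun_reduced_by_def nonconstant_to_fract)
  qed
  show ?thesis
  proof
    assume "\<exists>a b c. heun_reduced_by d q \<alpha> \<beta> \<gamma> \<delta> \<epsilon> a b c (to_fract r)"
    then show "\<alpha> * \<beta> \<noteq> 0 \<and> reducing ?E ?\<kappa> ?p r"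
      unfolding key reducing_def by blast
  next
    assume *: "\<alpha> * \<beta> \<noteq> 0 \<and> reducing ?E ?\<kappa> ?p r"
    then obtain C C' where bal: "balanced ?E ?\<kappa> ?p r C C'" and pell: "pell ?E ?p r"
      by (auto simp: reducing_def)
    \<comment> \<open>The numbers \<open>a\<close> and \<open>b\<close> are the roots of the
      quadratic polynomial with root sum \<open>C + C'\<close> and root product \<open>P\<close>;
      \<open>w\<close> is a square root of its discriminant.\<close>
    define P where "P = \<alpha> * \<beta> / (of_nat (degree r))\<^sup>2"
    define w where "w = csqrt ((C + C')\<^sup>2 - 4 * P)"
    define a where "a = (C + C' + w) / 2"
    define b where "b = (C + C' - w) / 2"
    have "a + b = C + C'" by (simp add: a_def b_def field_simps)
    moreover have "a * b = P"
    proof -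
      have "a * b = ((C + C')\<^sup>2 - w\<^sup>2) / 4"
        by (simp add: a_def b_def power2_eq_square algebra_simps)
      then show ?thesis by (simp add: w_def)
    qed
    moreover have "of_nat (degree r) \<noteq> (0::complex)" using pell by (simp add: pell_def)
    ultimately have "heun_reduced_by d q \<alpha> \<beta> \<gamma> \<delta> \<epsilon> a b (C + 1/2) (to_fract r)"
      unfolding key using * bal pell by (simp add: P_def algebra_simps)
    then show "\<exists>a b c. heun_reduced_by d q \<alpha> \<beta> \<gamma> \<delta> \<epsilon> a b c (to_fract r)" by blast
  qed
qed

section \<open>Symmetries of the Pell equation\<close>

text \<open>This is the exchange of \<open>z\<close> and \<open>1 - z\<close> in the hypergeometric
  equation: the Pell equation is unchanged, and \<open>C\<close> and \<open>C'\<close> swap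
  roles.\<close>

lemma reducing_complement:
  assumes "reducing E \<kappa> p r"
  shows "reducing E \<kappa> p (1 - r)"
proof -
  have deg: "0 < degree r" using assms by (simp add: reducing_def pell_def)
  have 1: "order s (1 - r) = order s (r - 1)" "order s (1 - r - 1) = order s r" for s
    using order_uminus[of s "r - 1"] by simp_all
  have "degree (1 - r) = degree r"
  proof -
    have "degree (- r + 1) = degree (- r)" using deg by (intro degree_add_eq_left) simp
    then show ?thesis by simp
  qed
  moreover have "(pderiv (1 - r))\<^sup>2 = (pderiv r)\<^sup>2"
    by (simp add: pderiv_diff power2_eq_square)
  moreover have "(1 - r) * (1 - r - 1) = r * (r - 1)" by (simp add: algebra_simps)
  ultimately have "pell E p (1 - r)"
    using assms by (simp only: reducing_def pell_def)
  moreover from assms obtain C C' where "balanced E \<kappa> p r C C'" by (auto simp: reducing_def)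
  then have "balanced E \<kappa> p (1 - r) C' C"
    unfolding balanced_def 1 by (simp add: add.commute)
  ultimately show ?thesis unfolding reducing_def by blast
qed

lemma pcompose_power: "pcompose (p ^ n) q = pcompose p q ^ n"
  by (induction n) (simp_all add: pcompose_mult pcompose_1)

lemma linear_factor_pcompose:
  "pcompose [:-poly [:n, m:] x, 1:] [:n, m:] = smult m [:-x, 1:]"
  for m :: complex
  by (simp add: pcompose_pCons)

text \<open>The substitution turns the linear factor at the image of \<open>s\<close> into a
  multiple of the linear factor at \<open>s\<close>, and the cofactor stays nonzero there.\<close>

lemma order_pcompose_linear:
  fixes r :: "complex poly"
  assumes "m \<noteq> 0" "r \<noteq> 0"
  shows "order s (pcompose r [:n, m:]) = order (poly [:n, m:] s) r"
proof -
  let ?A = "[:n, m:]" and ?a = "poly [:n, m:] s"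
  obtain w where w: "r = [:-?a, 1:] ^ order ?a r * w" "\<not> [:-?a, 1:] dvd w"
    using order_decomp[OF assms(2)] by blast
  define k where "k = order ?a r"
  have "pcompose r ?A = smult m [:-s, 1:] ^ k * pcompose w ?A"
    by (subst w(1)) (simp only: k_def pcompose_mult pcompose_power linear_factor_pcompose)
  also have "\<dots> = smult (m ^ k) ([:-s, 1:] ^ k * pcompose w ?A)"
    by (simp only: smult_power mult_smult_left)
  finally have e: "pcompose r ?A = smult (m ^ k) ([:-s, 1:] ^ k * pcompose w ?A)" .
  have w0: "poly (pcompose w ?A) s \<noteq> 0"
    using w(2) by (simp add: poly_pcompose dvd_iff_poly_eq_0 add.commute mult.commute)
  then have "pcompose w ?A \<noteq> 0" by force
  then have "[:-s, 1:] ^ k * pcompose w ?A \<noteq> 0" by simp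
  then have "order s (pcompose r ?A) = order s ([:-s, 1:] ^ k) + order s (pcompose w ?A)"
    unfolding e order_smult[OF power_not_zero[OF assms(1)]] by (rule order_mult)
  then show ?thesis
    by (simp only: order_power_n_n order_0I[OF w0] k_def add_0_right)
qed

text \<open>The powers of \<open>m\<close> balance because there are three vertices: the product
  over \<open>E\<close> yields \<open>m^3\<close>, the factor at \<open>p\<close> yields
  \<open>m\<close>, and the quotient \<open>m^2\<close> is what the chain rule adds to the squared
  derivative.\<close>

lemma pell_pcompose:
  assumes "m \<noteq> 0" "card E = 3" "pell (poly [:n, m:] ` E) (poly [:n, m:] p) r"
  shows "pell E p (pcompose r [:n, m:])"
proof -
  let ?A = "[:n, m:]"
  have inj: "inj_on (poly ?A) E" using assms(1) by (auto simp: inj_on_def)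
  have deg: "0 < degree r" "degree (pcompose r ?A) = degree r"
    using assms by (auto simp: pell_def degree_pcompose)
  have "pcompose ((pderiv r)\<^sup>2 * (\<Prod>x\<in>poly ?A ` E. [:-x, 1:])) ?A =
      pcompose (smult ((of_nat (degree r))\<^sup>2) ([:-poly ?A p, 1:] * (r * (r - 1)))) ?A"
    using assms(3) by (simp only: pell_def)
  also have "pcompose ((pderiv r)\<^sup>2 * (\<Prod>x\<in>poly ?A ` E. [:-x, 1:])) ?A =
      (pcompose (pderiv r) ?A)\<^sup>2 * (\<Prod>x\<in>E. smult m [:-x, 1:])"
    by (simp only: pcompose_mult pcompose_power pcompose_prod prod.reindex[OF inj] o_def linear_factor_pcompose)
  also have "(\<Prod>x\<in>E. smult m [:-x, 1:]) = smult (m ^ 3) (\<Prod>x\<in>E. [:-x, 1:])"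
    by (simp only: prod_smult prod_constant assms(2))
  also have "pcompose (smult ((of_nat (degree r))\<^sup>2) ([:-poly ?A p, 1:] * (r * (r - 1)))) ?A =
      smult ((of_nat (degree r))\<^sup>2) (smult m [:-p, 1:] * (pcompose r ?A * (pcompose r ?A - 1)))"
    by (simp only: pcompose_mult pcompose_smult pcompose_diff pcompose_1 linear_factor_pcompose)
  finally have "smult m (smult (m\<^sup>2) ((pcompose (pderiv r) ?A)\<^sup>2) * (\<Prod>x\<in>E. [:-x, 1:])) =
      smult m (smult ((of_nat (degree r))\<^sup>2) ([:-p, 1:] * (pcompose r ?A * (pcompose r ?A - 1))))"
    by (simp add: power3_eq_cube power2_eq_square mult_ac del: mult_pCons_left mult_pCons_right smult_pCons)
  moreover have "pderiv (pcompose r ?A) = smult m (pcompose (pderiv r) ?A)"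
    by (simp add: pderiv_pcompose pderiv_pCons)
  ultimately show ?thesis
    using assms(1) deg by (simp add: pell_def smult_power smult_cancel)
qed

lemma reducing_pcompose:
  assumes "degree A = 1" "card E = 3" "reducing (poly A ` E) \<kappa> (poly A p) r"
  shows "reducing E (\<lambda>x. \<kappa> (poly A x)) p (pcompose r A)"
proof -
  obtain n m where A: "A = [:n, m:]" and m: "m \<noteq> 0"
    using assms(1) by (metis degree1_coeffs)
  have pell: "pell (poly A ` E) (poly A p) r" using assms by (simp add: reducing_def)
  then have nz: "r \<noteq> 0" "r - 1 \<noteq> 0"
    using nonconstant_nonzero by (auto simp: pell_def)
  have inj: "poly A x = poly A y \<longleftrightarrow> x = y" for x y using m by (simp add: A)
  have ord: "order s (pcompose r A) = order (poly A s) r"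
      "order s (pcompose r A - 1) = order (poly A s) (r - 1)" for s
    using order_pcompose_linear[OF m nz(1)] order_pcompose_linear[OF m nz(2)]
    by (simp_all only: A pcompose_diff pcompose_1)
  from assms(3) obtain C C' where "balanced (poly A ` E) \<kappa> (poly A p) r C C'" by (auto simp: reducing_def)
  then have "balanced E (\<lambda>x. \<kappa> (poly A x)) p (pcompose r A) C C'"
    unfolding balanced_def ord using inj by (auto simp: image_iff of_bool_def)
  moreover have "pell E p (pcompose r A)"
    using pell_pcompose[OF m assms(2)] pell by (simp only: A)
  ultimately show ?thesis unfolding reducing_def by blast
qed

lemma pell_iff_poly:
  assumes "finite E"
  shows "pell E p r \<longleftrightarrow> 0 < degree r \<and> (\<forall>x. (poly (pderiv r) x)\<^sup>2 * (\<Prod>e\<in>E. x - e) =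
    (of_nat (degree r))\<^sup>2 * ((x - p) * (poly r x * (poly r x - 1))))"
  unfolding pell_def poly_eq_poly_eq_iff[symmetric] by (auto simp: fun_eq_iff poly_prod simp del: mult_pCons_left)

section \<open>Pell equation on a normalized triangle\<close>

lemma pell_triangle_iff:
  assumes "D \<noteq> 0" "D \<noteq> 1"
  shows "pell {0, 1, D} p r \<longleftrightarrow> 0 < degree r \<and> (\<forall>x. (poly (pderiv r) x)\<^sup>2 * (x * (x - 1) * (x - D)) =
    (of_nat (degree r))\<^sup>2 * ((x - p) * (poly r x * (poly r x - 1))))"
  using assms by (simp add: pell_iff_poly mult.assoc)

text \<open>For a polynomial of prescribed shape, both sides of the Pell equation share an explicit
  factor \<open>M\<close>. Cancelling it leaves the cofactors \<open>L\<close> and \<open>N\<close>,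
  whose coefficients are then compared.\<close>

lemma pell_triangle_reduce:
  assumes "D \<noteq> 0" "D \<noteq> 1" "degree r = n" "0 < n" "M \<noteq> 0"
    "\<And>x. (poly (pderiv r) x)\<^sup>2 * (x * (x - 1) * (x - D)) = poly M x * poly L x"
    "\<And>x. (of_nat n)\<^sup>2 * ((x - p) * (poly r x * (poly r x - 1))) = poly M x * poly N x"
  shows "pell {0, 1, D} p r \<longleftrightarrow> L = N"
proof -
  have "pell {0, 1, D} p r \<longleftrightarrow> (\<forall>x. poly M x * poly L x = poly M x * poly N x)"
    using pell_triangle_iff[OF assms(1,2)] assms(3,4,6,7) by simp
  also have "\<dots> \<longleftrightarrow> M * L = M * N"
    unfolding poly_eq_poly_eq_iff[symmetric] by (simp add: fun_eq_iff)
  finally show ?thesis using assms(5) by simp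
qed

text \<open>The pattern for all seven shapes: \<open>M\<close> collects the zeros of
  \<open>r\<close> and the factor at \<open>p\<close>; \<open>N\<close> is a constant multiple of
  \<open>r - 1\<close>; \<open>L\<close> consists of the factors of the vertices that are not zeros
  of \<open>r\<close> and the squared cofactor of the derivative. The second highest coefficients
  determine \<open>D\<close> or relate it linearly to \<open>p\<close>.\<close>

lemma pell_normal_1a:
  assumes "K \<noteq> 0" "D \<noteq> 0" "D \<noteq> 1"
  shows "pell {0, 1, D} 1 (smult K ([:-1, 1:]\<^sup>2)) \<longleftrightarrow> D = 2 \<and> K = 1"
proof -
  have "pell {0, 1, D} 1 (smult K ([:-1, 1:]\<^sup>2)) \<longleftrightarrow> [:0, - (K * D), K:] = [:K - 1, - (2 * K), K:]"
  proof (rule pell_triangle_reduce[OF assms(2,3), where n = 2 and M = "smult (4 * K) ([:-1, 1:] ^ 3)"])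
    show "degree (smult K ([:-1, 1:]\<^sup>2)) = 2"
      using assms(1) by (simp add: degree_mult_eq degree_power_eq del: mult_pCons_left mult_pCons_right)
    show "smult (4 * K) ([:-1, 1:] ^ 3) \<noteq> 0"
      using assms(1) by (simp del: mult_pCons_left mult_pCons_right)
  qed (simp_all add: pderiv_smult pderiv_mult pderiv_pCons power2_eq_square power3_eq_cube eval_nat_numeral algebra_simps
      del: smult_pCons mult_pCons_left mult_pCons_right)
  also have "\<dots> \<longleftrightarrow> D = 2 \<and> K = 1"
  proof
    assume "[:0, - (K * D), K:] = [:K - 1, - (2 * K), K:]"
    note eqs = this[unfolded pCons_eq_iff]
    have "K * (D - 2) = 0" using eqs  by algebra
    then have e0: "D = 2" using assms(1) by simp
    have e1: "K = 1" using eqs e0 by algebra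
    show "D = 2 \<and> K = 1" using e0 e1 by blast
  next
    assume *: "D = 2 \<and> K = 1"
    show "[:0, - (K * D), K:] = [:K - 1, - (2 * K), K:]"
      unfolding pCons_eq_iff using * by (simp add: power2_eq_square)
  qed
  finally show ?thesis .
qed

lemma pell_normal_1b:
  assumes "K \<noteq> 0" "D \<noteq> 0" "D \<noteq> 1"
  shows "pell {0, 1, D} 1 (smult K ([:-1, 1:]\<^sup>2 * [:-D, 1:])) \<longleftrightarrow> D = 4 \<and> K = -1/4"
proof -
  \<comment> \<open>The derivative is \<open>K * (t - 1) * (3 * t - (2 * D + 1))\<close>; the square
    of its last factor, times \<open>K * t\<close>, is the left cofactor.\<close>
  have "pell {0, 1, D} 1 (smult K ([:-1, 1:]\<^sup>2 * [:-D, 1:])) \<longleftrightarrow> [:0, K * (2 * D + 1)\<^sup>2, - (6 * K * (2 * D + 1)), 9 * K:] = [:-9 * (K * D + 1), 9 * K * (2 * D + 1), - (9 * K * (D + 2)), 9 * K:]"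
  proof (rule pell_triangle_reduce[OF assms(2,3), where n = 3 and M = "smult K ([:-1, 1:] ^ 3 * [:-D, 1:])"])
    show "degree (smult K ([:-1, 1:]\<^sup>2 * [:-D, 1:])) = 3"
      using assms(1) by (simp add: degree_mult_eq degree_power_eq del: mult_pCons_left mult_pCons_right)
    show "smult K ([:-1, 1:] ^ 3 * [:-D, 1:]) \<noteq> 0"
      using assms(1) by (simp del: mult_pCons_left mult_pCons_right)
  qed (simp_all add: pderiv_smult pderiv_mult pderiv_pCons power2_eq_square power3_eq_cube eval_nat_numeral algebra_simps
      del: smult_pCons mult_pCons_left mult_pCons_right)
  also have "\<dots> \<longleftrightarrow> D = 4 \<and> K = -1/4"
  proof
    assume "[:0, K * (2 * D + 1)\<^sup>2, - (6 * K * (2 * D + 1)), 9 * K:] = [:-9 * (K * D + 1), 9 * K * (2 * D + 1), - (9 * K * (D + 2)), 9 * K:]"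
    note eqs = this[unfolded pCons_eq_iff]
    have "K * (D - 4) = 0" using eqs  by algebra
    then have e0: "D = 4" using assms(1) by simp
    have "4 * K = -1" using eqs e0 by algebra
    then have e1: "K = -1/4" by (simp only: eq_divide_eq) (simp add: mult.commute)
    show "D = 4 \<and> K = -1/4" using e0 e1 by blast
  next
    assume *: "D = 4 \<and> K = -1/4"
    show "[:0, K * (2 * D + 1)\<^sup>2, - (6 * K * (2 * D + 1)), 9 * K:] = [:-9 * (K * D + 1), 9 * K * (2 * D + 1), - (9 * K * (D + 2)), 9 * K:]"
      unfolding pCons_eq_iff using * by (simp add: power2_eq_square)
  qed
  finally show ?thesis .
qed

lemma pell_normal_1c:
  assumes "K \<noteq> 0" "D \<noteq> 0" "D \<noteq> 1"
  shows "pell {0, 1, D} 1 (smult K ([:-1, 1:]\<^sup>2 * [:0, 1:] * [:-D, 1:])) \<longleftrightarrow> D = 2 \<and> K = -4"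
proof -
  \<comment> \<open>The derivative is \<open>K * (t - 1)\<close> times
    \<open>4 * t^2 - (2 + 3 * D) * t + D\<close>; no vertex factor remains on the left.\<close>
  have "pell {0, 1, D} 1 (smult K ([:-1, 1:]\<^sup>2 * [:0, 1:] * [:-D, 1:])) \<longleftrightarrow> [:K * D\<^sup>2, - (2 * K * (2 + 3 * D) * D), K * ((2 + 3 * D)\<^sup>2 + 8 * D), - (8 * K * (2 + 3 * D)), 16 * K:] = [:-16, - (16 * K * D), 16 * K * (1 + 2 * D), - (16 * K * (2 + D)), 16 * K:]"
  proof (rule pell_triangle_reduce[OF assms(2,3), where n = 4 and M = "smult K ([:-1, 1:] ^ 3 * [:0, 1:] * [:-D, 1:])"])
    show "degree (smult K ([:-1, 1:]\<^sup>2 * [:0, 1:] * [:-D, 1:])) = 4"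
      using assms(1) by (simp add: degree_mult_eq degree_power_eq del: mult_pCons_left mult_pCons_right)
    show "smult K ([:-1, 1:] ^ 3 * [:0, 1:] * [:-D, 1:]) \<noteq> 0"
      using assms(1) by (simp del: mult_pCons_left mult_pCons_right)
  qed (simp_all add: pderiv_smult pderiv_mult pderiv_pCons power2_eq_square power3_eq_cube eval_nat_numeral algebra_simps
      del: smult_pCons mult_pCons_left mult_pCons_right)
  also have "\<dots> \<longleftrightarrow> D = 2 \<and> K = -4"
  proof
    assume "[:K * D\<^sup>2, - (2 * K * (2 + 3 * D) * D), K * ((2 + 3 * D)\<^sup>2 + 8 * D), - (8 * K * (2 + 3 * D)), 16 * K:] = [:-16, - (16 * K * D), 16 * K * (1 + 2 * D), - (16 * K * (2 + D)), 16 * K:]"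
    note eqs = this[unfolded pCons_eq_iff]
    have "K * (D - 2) = 0" using eqs  by algebra
    then have e0: "D = 2" using assms(1) by simp
    have "4 * K = -16" using eqs e0 by algebra
    then have e1: "K = -4" by simp
    show "D = 2 \<and> K = -4" using e0 e1 by blast
  next
    assume *: "D = 2 \<and> K = -4"
    show "[:K * D\<^sup>2, - (2 * K * (2 + 3 * D) * D), K * ((2 + 3 * D)\<^sup>2 + 8 * D), - (8 * K * (2 + 3 * D)), 16 * K:] = [:-16, - (16 * K * D), 16 * K * (1 + 2 * D), - (16 * K * (2 + D)), 16 * K:]"
      unfolding pCons_eq_iff using * by (simp add: power2_eq_square)
  qed
  finally show ?thesis .
qed

lemma pell_normal_2a:
  assumes "K \<noteq> 0" "D \<noteq> 0" "D \<noteq> 1"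
  shows "pell {0, 1, D} p (smult K ([:-p, 1:] ^ 3)) \<longleftrightarrow> 1 + D = 3 * p \<and> D = 3 * p\<^sup>2 \<and> K * p ^ 3 = -1"
proof -
  have "pell {0, 1, D} p (smult K ([:-p, 1:] ^ 3)) \<longleftrightarrow> [:0, K * D, - (K * (1 + D)), K:] = [:- (K * p ^ 3) - 1, 3 * K * p\<^sup>2, - (3 * K * p), K:]"
  proof (rule pell_triangle_reduce[OF assms(2,3), where n = 3 and M = "smult (9 * K) ([:-p, 1:] ^ 4)"])
    show "degree (smult K ([:-p, 1:] ^ 3)) = 3"
      using assms(1) by (simp add: degree_mult_eq degree_power_eq del: mult_pCons_left mult_pCons_right)
    show "smult (9 * K) ([:-p, 1:] ^ 4) \<noteq> 0"
      using assms(1) by (simp del: mult_pCons_left mult_pCons_right)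
  qed (simp_all add: pderiv_smult pderiv_mult pderiv_pCons power2_eq_square power3_eq_cube eval_nat_numeral algebra_simps
      del: smult_pCons mult_pCons_left mult_pCons_right)
  also have "\<dots> \<longleftrightarrow> 1 + D = 3 * p \<and> D = 3 * p\<^sup>2 \<and> K * p ^ 3 = -1"
  proof
    assume "[:0, K * D, - (K * (1 + D)), K:] = [:- (K * p ^ 3) - 1, 3 * K * p\<^sup>2, - (3 * K * p), K:]"
    note eqs = this[unfolded pCons_eq_iff]
    have "K * (1 + D - 3 * p) = 0" using eqs  by algebra
    then have e0: "1 + D = 3 * p" using assms(1) by simp
    have "K * (D - 3 * p\<^sup>2) = 0" using eqs e0 by algebra
    then have e1: "D = 3 * p\<^sup>2" using assms(1) by simp
    have e2: "K * p ^ 3 = -1" using eqs e0 e1 by algebra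
    show "1 + D = 3 * p \<and> D = 3 * p\<^sup>2 \<and> K * p ^ 3 = -1" using e0 e1 e2 by blast
  next
    assume *: "1 + D = 3 * p \<and> D = 3 * p\<^sup>2 \<and> K * p ^ 3 = -1"
    show "[:0, K * D, - (K * (1 + D)), K:] = [:- (K * p ^ 3) - 1, 3 * K * p\<^sup>2, - (3 * K * p), K:]"
      unfolding pCons_eq_iff by (intro conjI refl; use * in algebra)
  qed
  finally show ?thesis .
qed

lemma pell_normal_2b:
  assumes "K \<noteq> 0" "D \<noteq> 0" "D \<noteq> 1"
  shows "pell {0, 1, D} p (smult K ([:-p, 1:] ^ 3 * [:-D, 1:])) \<longleftrightarrow> D = 5 * p - 2 \<and> 8 * p\<^sup>2 - 8 * p + 3 = 0 \<and> K * D * p ^ 3 = 1"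
proof -
  \<comment> \<open>The derivative is \<open>K * (t - p)^2 * (4 * t - (3 * D + p))\<close>; the
    factors of the vertices 0 and 1 remain on the left.\<close>
  have "pell {0, 1, D} p (smult K ([:-p, 1:] ^ 3 * [:-D, 1:])) \<longleftrightarrow> [:0, - (K * (3 * D + p)\<^sup>2), K * ((3 * D + p)\<^sup>2 + 8 * (3 * D + p)), - (K * (16 + 8 * (3 * D + p))), 16 * K:] = [:16 * (K * D * p ^ 3 - 1), - (16 * K * (p ^ 3 + 3 * p\<^sup>2 * D)), 48 * K * (p\<^sup>2 + p * D), - (16 * K * (3 * p + D)), 16 * K:]"
  proof (rule pell_triangle_reduce[OF assms(2,3), where n = 4 and M = "smult K ([:-p, 1:] ^ 4 * [:-D, 1:])"])
    show "degree (smult K ([:-p, 1:] ^ 3 * [:-D, 1:])) = 4"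
      using assms(1) by (simp add: degree_mult_eq degree_power_eq del: mult_pCons_left mult_pCons_right)
    show "smult K ([:-p, 1:] ^ 4 * [:-D, 1:]) \<noteq> 0"
      using assms(1) by (simp del: mult_pCons_left mult_pCons_right)
  qed (simp_all add: pderiv_smult pderiv_mult pderiv_pCons power2_eq_square power3_eq_cube eval_nat_numeral algebra_simps
      del: smult_pCons mult_pCons_left mult_pCons_right)
  also have "\<dots> \<longleftrightarrow> D = 5 * p - 2 \<and> 8 * p\<^sup>2 - 8 * p + 3 = 0 \<and> K * D * p ^ 3 = 1"
  proof
    assume "[:0, - (K * (3 * D + p)\<^sup>2), K * ((3 * D + p)\<^sup>2 + 8 * (3 * D + p)), - (K * (16 + 8 * (3 * D + p))), 16 * K:] = [:16 * (K * D * p ^ 3 - 1), - (16 * K * (p ^ 3 + 3 * p\<^sup>2 * D)), 48 * K * (p\<^sup>2 + p * D), - (16 * K * (3 * p + D)), 16 * K:]"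
    note eqs = this[unfolded pCons_eq_iff]
    have "K * (D - (5 * p - 2)) = 0" using eqs  by algebra
    then have e0: "D = 5 * p - 2" using assms(1) by simp
    have "K * (8 * p\<^sup>2 - 8 * p + 3) = 0" using eqs e0 by algebra
    then have e1: "8 * p\<^sup>2 - 8 * p + 3 = 0" using assms(1) by simp
    have e2: "K * D * p ^ 3 = 1" using eqs e0 e1 by algebra
    show "D = 5 * p - 2 \<and> 8 * p\<^sup>2 - 8 * p + 3 = 0 \<and> K * D * p ^ 3 = 1" using e0 e1 e2 by blast
  next
    assume *: "D = 5 * p - 2 \<and> 8 * p\<^sup>2 - 8 * p + 3 = 0 \<and> K * D * p ^ 3 = 1"
    show "[:0, - (K * (3 * D + p)\<^sup>2), K * ((3 * D + p)\<^sup>2 + 8 * (3 * D + p)), - (K * (16 + 8 * (3 * D + p))), 16 * K:] = [:16 * (K * D * p ^ 3 - 1), - (16 * K * (p ^ 3 + 3 * p\<^sup>2 * D)), 48 * K * (p\<^sup>2 + p * D), - (16 * K * (3 * p + D)), 16 * K:]"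
      unfolding pCons_eq_iff by (intro conjI refl; use * in algebra)
  qed
  finally show ?thesis .
qed

lemma pell_normal_2c:
  assumes "K \<noteq> 0" "D \<noteq> 0" "D \<noteq> 1"
  shows "pell {0, 1, D} p (smult K ([:-p, 1:] ^ 3 * [:0, 1:] * [:-1, 1:])) \<longleftrightarrow> 5 * D = 11 * p - 3 \<and> 27 * p\<^sup>2 - 27 * p + 8 = 0 \<and> K * D * p\<^sup>2 = 25"
proof -
  \<comment> \<open>The derivative is \<open>K * (t - p)^2\<close> times
    \<open>5 * t^2 - (4 + 2 * p) * t + p\<close>; the factor of the vertex \<open>D\<close> remains
    on the left.\<close>
  have "pell {0, 1, D} p (smult K ([:-p, 1:] ^ 3 * [:0, 1:] * [:-1, 1:])) \<longleftrightarrow> [:- (K * D * p\<^sup>2), K * (p\<^sup>2 + 2 * (4 + 2 * p) * p * D), - (K * (2 * (4 + 2 * p) * p + D * ((4 + 2 * p)\<^sup>2 + 10 * p))), K * ((4 + 2 * p)\<^sup>2 + 10 * p + 10 * (4 + 2 * p) * D), - (K * (10 * (4 + 2 * p) + 25 * D)), 25 * K:] = [:-25, 25 * K * p ^ 3, - (25 * K * (3 * p\<^sup>2 + p ^ 3)), 75 * K * (p + p\<^sup>2), - (25 * K * (1 + 3 * p)), 25 * K:]"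
  proof (rule pell_triangle_reduce[OF assms(2,3), where n = 5 and M = "smult K ([:-p, 1:] ^ 4 * [:0, 1:] * [:-1, 1:])"])
    show "degree (smult K ([:-p, 1:] ^ 3 * [:0, 1:] * [:-1, 1:])) = 5"
      using assms(1) by (simp add: degree_mult_eq degree_power_eq del: mult_pCons_left mult_pCons_right)
    show "smult K ([:-p, 1:] ^ 4 * [:0, 1:] * [:-1, 1:]) \<noteq> 0"
      using assms(1) by (simp del: mult_pCons_left mult_pCons_right)
  qed (simp_all add: pderiv_smult pderiv_mult pderiv_pCons power2_eq_square power3_eq_cube eval_nat_numeral algebra_simps
      del: smult_pCons mult_pCons_left mult_pCons_right)
  also have "\<dots> \<longleftrightarrow> 5 * D = 11 * p - 3 \<and> 27 * p\<^sup>2 - 27 * p + 8 = 0 \<and> K * D * p\<^sup>2 = 25"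
  proof
    assume "[:- (K * D * p\<^sup>2), K * (p\<^sup>2 + 2 * (4 + 2 * p) * p * D), - (K * (2 * (4 + 2 * p) * p + D * ((4 + 2 * p)\<^sup>2 + 10 * p))), K * ((4 + 2 * p)\<^sup>2 + 10 * p + 10 * (4 + 2 * p) * D), - (K * (10 * (4 + 2 * p) + 25 * D)), 25 * K:] = [:-25, 25 * K * p ^ 3, - (25 * K * (3 * p\<^sup>2 + p ^ 3)), 75 * K * (p + p\<^sup>2), - (25 * K * (1 + 3 * p)), 25 * K:]"
    note eqs = this[unfolded pCons_eq_iff]
    have "K * (5 * D - (11 * p - 3)) = 0" using eqs  by algebra
    then have e0: "5 * D = 11 * p - 3" using assms(1) by simp
    have "K * (27 * p\<^sup>2 - 27 * p + 8) = 0" using eqs e0 by algebra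
    then have e1: "27 * p\<^sup>2 - 27 * p + 8 = 0" using assms(1) by simp
    have e2: "K * D * p\<^sup>2 = 25" using eqs e0 e1 by algebra
    show "5 * D = 11 * p - 3 \<and> 27 * p\<^sup>2 - 27 * p + 8 = 0 \<and> K * D * p\<^sup>2 = 25" using e0 e1 e2 by blast
  next
    assume *: "5 * D = 11 * p - 3 \<and> 27 * p\<^sup>2 - 27 * p + 8 = 0 \<and> K * D * p\<^sup>2 = 25"
    show "[:- (K * D * p\<^sup>2), K * (p\<^sup>2 + 2 * (4 + 2 * p) * p * D), - (K * (2 * (4 + 2 * p) * p + D * ((4 + 2 * p)\<^sup>2 + 10 * p))), K * ((4 + 2 * p)\<^sup>2 + 10 * p + 10 * (4 + 2 * p) * D), - (K * (10 * (4 + 2 * p) + 25 * D)), 25 * K:] = [:-25, 25 * K * p ^ 3, - (25 * K * (3 * p\<^sup>2 + p ^ 3)), 75 * K * (p + p\<^sup>2), - (25 * K * (1 + 3 * p)), 25 * K:]"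
      unfolding pCons_eq_iff by (intro conjI refl; use * in algebra)
  qed
  finally show ?thesis .
qed

lemma pell_normal_2d:
  assumes "K \<noteq> 0" "D \<noteq> 0" "D \<noteq> 1"
  shows "pell {0, 1, D} p (smult K ([:-p, 1:] ^ 3 * [:0, 1:] * [:-1, 1:] * [:-D, 1:])) \<longleftrightarrow> 1 + D = 3 * p \<and> D = 3 * p\<^sup>2 \<and> K * p ^ 6 = -4"
proof -
  have "pell {0, 1, D} p (smult K ([:-p, 1:] ^ 3 * [:0, 1:] * [:-1, 1:] * [:-D, 1:])) \<longleftrightarrow> [:K * (p * D)\<^sup>2, - (2 * K * (4 * D + 2 * (1 + D) * p) * (p * D)), K * ((4 * D + 2 * (1 + D) * p)\<^sup>2 + 2 * (5 * (1 + D) + 3 * p) * (p * D)), - (K * (12 * (p * D) + 2 * (5 * (1 + D) + 3 * p) * (4 * D + 2 * (1 + D) * p))), K * ((5 * (1 + D) + 3 * p)\<^sup>2 + 12 * (4 * D + 2 * (1 + D) * p)), - (12 * K * (5 * (1 + D) + 3 * p)), 36 * K:] = [:-36, - (36 * K * p ^ 3 * D), 36 * K * (p ^ 3 * (1 + D) + 3 * p\<^sup>2 * D), - (36 * K * (p ^ 3 + 3 * p\<^sup>2 * (1 + D) + 3 * p * D)), 36 * K * (3 * p\<^sup>2 + 3 * p * (1 + D) + D), - (36 * K * (3 * p + (1 + D))), 36 * K:]"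
  proof (rule pell_triangle_reduce[OF assms(2,3), where n = 6 and M = "smult K ([:-p, 1:] ^ 4 * [:0, 1:] * [:-1, 1:] * [:-D, 1:])"])
    show "degree (smult K ([:-p, 1:] ^ 3 * [:0, 1:] * [:-1, 1:] * [:-D, 1:])) = 6"
      using assms(1) by (simp add: degree_mult_eq degree_power_eq del: mult_pCons_left mult_pCons_right)
    show "smult K ([:-p, 1:] ^ 4 * [:0, 1:] * [:-1, 1:] * [:-D, 1:]) \<noteq> 0"
      using assms(1) by (simp del: mult_pCons_left mult_pCons_right)
    show "(poly (pderiv (smult K ([:-p, 1:] ^ 3 * [:0, 1:] * [:-1, 1:] * [:-D, 1:]))) x)\<^sup>2 * (x * (x - 1) * (x - D)) =
      poly (smult K ([:-p, 1:] ^ 4 * [:0, 1:] * [:-1, 1:] * [:-D, 1:])) x * poly [:K * (p * D)\<^sup>2, - (2 * K * (4 * D + 2 * (1 + D) * p) * (p * D)), K * ((4 * D + 2 * (1 + D) * p)\<^sup>2 + 2 * (5 * (1 + D) + 3 * p) * (p * D)), - (K * (12 * (p * D) + 2 * (5 * (1 + D) + 3 * p) * (4 * D + 2 * (1 + D) * p))), K * ((5 * (1 + D) + 3 * p)\<^sup>2 + 12 * (4 * D + 2 * (1 + D) * p)), - (12 * K * (5 * (1 + D) + 3 * p)), 36 * K:] x" for x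
    proof -
      \<comment> \<open>\<open>Q\<close> is the cofactor of \<open>K * (x - p)^2\<close> in the
        derivative, so the long polynomial on the right of the goal takes the value
        \<open>K * Q^2\<close> at \<open>x\<close>.\<close>
      define Q where "Q = 6 * x ^ 3 - (5 * (1 + D) + 3 * p) * x\<^sup>2 + (4 * D + 2 * (1 + D) * p) * x - p * D"
      have "poly (pderiv (smult K ([:-p, 1:] ^ 3 * [:0, 1:] * [:-1, 1:] * [:-D, 1:]))) x = K * (x - p)\<^sup>2 * Q"
        by (simp add: Q_def pderiv_smult pderiv_mult pderiv_pCons power2_eq_square power3_eq_cube algebra_simps
            del: smult_pCons mult_pCons_left mult_pCons_right)
      moreover have "poly [:K * (p * D)\<^sup>2, - (2 * K * (4 * D + 2 * (1 + D) * p) * (p * D)), K * ((4 * D + 2 * (1 + D) * p)\<^sup>2 + 2 * (5 * (1 + D) + 3 * p) * (p * D)), - (K * (12 * (p * D) + 2 * (5 * (1 + D) + 3 * p) * (4 * D + 2 * (1 + D) * p))), K * ((5 * (1 + D) + 3 * p)\<^sup>2 + 12 * (4 * D + 2 * (1 + D) * p)), - (12 * K * (5 * (1 + D) + 3 * p)), 36 * K:] x = K * Q\<^sup>2"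
        unfolding Q_def by (simp add: power2_eq_square power3_eq_cube algebra_simps)
      ultimately show ?thesis
        by (simp add: power2_eq_square eval_nat_numeral del: smult_pCons mult_pCons_left mult_pCons_right)
    qed
    show "(of_nat 6)\<^sup>2 * ((x - p) * (poly (smult K ([:-p, 1:] ^ 3 * [:0, 1:] * [:-1, 1:] * [:-D, 1:])) x * (poly (smult K ([:-p, 1:] ^ 3 * [:0, 1:] * [:-1, 1:] * [:-D, 1:])) x - 1))) =
      poly (smult K ([:-p, 1:] ^ 4 * [:0, 1:] * [:-1, 1:] * [:-D, 1:])) x * poly [:-36, - (36 * K * p ^ 3 * D), 36 * K * (p ^ 3 * (1 + D) + 3 * p\<^sup>2 * D), - (36 * K * (p ^ 3 + 3 * p\<^sup>2 * (1 + D) + 3 * p * D)), 36 * K * (3 * p\<^sup>2 + 3 * p * (1 + D) + D), - (36 * K * (3 * p + (1 + D))), 36 * K:] x" for x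
    proof -
      have N: "poly [:-36, - (36 * K * p ^ 3 * D), 36 * K * (p ^ 3 * (1 + D) + 3 * p\<^sup>2 * D), - (36 * K * (p ^ 3 + 3 * p\<^sup>2 * (1 + D) + 3 * p * D)), 36 * K * (3 * p\<^sup>2 + 3 * p * (1 + D) + D), - (36 * K * (3 * p + (1 + D))), 36 * K:] x = 36 * (poly (smult K ([:-p, 1:] ^ 3 * [:0, 1:] * [:-1, 1:] * [:-D, 1:])) x - 1)"
        by (simp add: power2_eq_square power3_eq_cube algebra_simps)
      have M: "poly (smult K ([:-p, 1:] ^ 4 * [:0, 1:] * [:-1, 1:] * [:-D, 1:])) x = (x - p) * poly (smult K ([:-p, 1:] ^ 3 * [:0, 1:] * [:-1, 1:] * [:-D, 1:])) x"
        by (simp add: eval_nat_numeral del: smult_pCons mult_pCons_left mult_pCons_right)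
      show ?thesis
        unfolding N M by (simp del: smult_pCons mult_pCons_left mult_pCons_right)
    qed
  qed simp
  also have "\<dots> \<longleftrightarrow> 1 + D = 3 * p \<and> D = 3 * p\<^sup>2 \<and> K * p ^ 6 = -4"
  proof
    assume "[:K * (p * D)\<^sup>2, - (2 * K * (4 * D + 2 * (1 + D) * p) * (p * D)), K * ((4 * D + 2 * (1 + D) * p)\<^sup>2 + 2 * (5 * (1 + D) + 3 * p) * (p * D)), - (K * (12 * (p * D) + 2 * (5 * (1 + D) + 3 * p) * (4 * D + 2 * (1 + D) * p))), K * ((5 * (1 + D) + 3 * p)\<^sup>2 + 12 * (4 * D + 2 * (1 + D) * p)), - (12 * K * (5 * (1 + D) + 3 * p)), 36 * K:] = [:-36, - (36 * K * p ^ 3 * D), 36 * K * (p ^ 3 * (1 + D) + 3 * p\<^sup>2 * D), - (36 * K * (p ^ 3 + 3 * p\<^sup>2 * (1 + D) + 3 * p * D)), 36 * K * (3 * p\<^sup>2 + 3 * p * (1 + D) + D), - (36 * K * (3 * p + (1 + D))), 36 * K:]"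
    note eqs = this[unfolded pCons_eq_iff]
    have "K * (1 + D - 3 * p) = 0" using eqs  by algebra
    then have e0: "1 + D = 3 * p" using assms(1) by simp
    have "K * (D - 3 * p\<^sup>2) = 0" using eqs e0 by algebra
    then have e1: "D = 3 * p\<^sup>2" using assms(1) by simp
    have e2: "K * p ^ 6 = -4" using eqs e0 e1 by algebra
    show "1 + D = 3 * p \<and> D = 3 * p\<^sup>2 \<and> K * p ^ 6 = -4" using e0 e1 e2 by blast
  next
    assume *: "1 + D = 3 * p \<and> D = 3 * p\<^sup>2 \<and> K * p ^ 6 = -4"
    show "[:K * (p * D)\<^sup>2, - (2 * K * (4 * D + 2 * (1 + D) * p) * (p * D)), K * ((4 * D + 2 * (1 + D) * p)\<^sup>2 + 2 * (5 * (1 + D) + 3 * p) * (p * D)), - (K * (12 * (p * D) + 2 * (5 * (1 + D) + 3 * p) * (4 * D + 2 * (1 + D) * p))), K * ((5 * (1 + D) + 3 * p)\<^sup>2 + 12 * (4 * D + 2 * (1 + D) * p)), - (12 * K * (5 * (1 + D) + 3 * p)), 36 * K:] = [:-36, - (36 * K * p ^ 3 * D), 36 * K * (p ^ 3 * (1 + D) + 3 * p\<^sup>2 * D), - (36 * K * (p ^ 3 + 3 * p\<^sup>2 * (1 + D) + 3 * p * D)), 36 * K * (3 * p\<^sup>2 + 3 * p * (1 + D) + D), - (36 * K * (3 * p + (1 + D))), 36 * K:]"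
      unfolding pCons_eq_iff by (intro conjI refl; use * in algebra)
  qed
  finally show ?thesis .
qed

section \<open>Distribution of the multiplicities\<close>

lemma degree_eq_sum_order:
  fixes q :: "complex poly"
  assumes "finite F" "\<And>s. poly q s = 0 \<Longrightarrow> s \<in> F" "q \<noteq> 0"
  shows "degree q = (\<Sum>s\<in>F. order s q)"
proof -
  have "degree q = degree (smult (lead_coeff q) (\<Prod>s\<in>F. [:-s, 1:] ^ order s q))"
    using complex_poly_prod_order[OF assms] by simp
  also have "\<dots> = (\<Sum>s\<in>F. degree ([:-s, 1:] ^ order s q))"
    using assms(3) by (simp add: degree_prod_eq_sum_degree)
  also have "\<dots> = (\<Sum>s\<in>F. order s q)"
    by (simp only: degree_linear_power)
  finally show ?thesis .
qed

text \<open>Where \<open>r\<close> vanishes, \<open>r - 1\<close> does not, and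
  \<open>pderiv r\<close> has order one less than \<open>r\<close>; \<open>pell_order\<close> then
  leaves a single value. A zero is simple at a vertex other than \<open>p\<close>, triple at
  \<open>p\<close> if \<open>p\<close> is no vertex, and double otherwise. The same holds for the
  points where \<open>r\<close> is 1.\<close>

lemma pell_root_order:
  assumes "finite E" "pell E p r"
  shows "poly r s = 0 \<Longrightarrow> order s r + of_bool (s \<in> E) = 2 + of_bool (s = p)"
    and "poly r s = 1 \<Longrightarrow> order s (r - 1) + of_bool (s \<in> E) = 2 + of_bool (s = p)"
proof -
  have nz: "r \<noteq> 0" "r - 1 \<noteq> 0" using assms(2) nonconstant_nonzero by (auto simp: pell_def)
  note ord = pell_order[OF assms, of s]
  { assume s: "poly r s = 0"
    then have "order s (r - 1) = 0" by (intro order_0I) simp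
    then show "order s r + of_bool (s \<in> E) = 2 + of_bool (s = p)"
      using ord order_pderiv[OF nz(1) s] by linarith }
  { assume s: "poly r s = 1"
    then have "order s r = 0" by (intro order_0I) simp
    moreover have "order s (r - 1) = Suc (order s (pderiv r))"
      using order_pderiv[OF nz(2), of s] s by (simp add: pderiv_diff)
    ultimately show "order s (r - 1) + of_bool (s \<in> E) = 2 + of_bool (s = p)"
      using ord by linarith }
qed

text \<open>By parity of the orders in the Pell equation.\<close>

lemma pell_value:
  assumes "finite E" "pell E p r" "(s \<in> E) \<noteq> (s = p)"
  shows "poly r s = 0 \<or> poly r s = 1"
proof (rule ccontr)
  assume "\<not> ?thesis"
  then have "order s r = 0" "order s (r - 1) = 0" by (auto intro: order_0I)
  then have "2 * order s (pderiv r) + of_bool (s \<in> E) = of_bool (s = p)"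
    using pell_order[OF assms(1,2), of s] by simp
  moreover have "of_bool (s \<in> E) + of_bool (s = p) = (1 :: nat)" using assms(3) by auto
  ultimately show False by presburger
qed

text \<open>In the applications \<open>Z\<close> is the set of vertices other than \<open>p\<close>
  at which the polynomial vanishes, and \<open>m\<close> is \<open>card (E - {p})\<close>.\<close>

definition normal_form :: "complex \<Rightarrow> complex \<Rightarrow> complex set \<Rightarrow> nat \<Rightarrow> complex poly" where
  "normal_form K p Z m = smult K ([:-p, 1:] ^ m * (\<Prod>e\<in>Z. [:-e, 1:]))"

lemma order_normal_form:
  assumes "finite Z" "K \<noteq> 0"
  shows "order s (normal_form K p Z m) = (if s = p then m else 0) + of_bool (s \<in> Z)"
proof -
  have "order s ([:-p, 1:] ^ m) = (if s = p then m else 0)"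
    by (auto simp: order_power_n_n order_0I)
  moreover have nz: "[:-p, 1:] ^ m * (\<Prod>e\<in>Z. [:-e, 1:]) \<noteq> 0"
    using assms(1) by (simp del: mult_pCons_left)
  ultimately show ?thesis
    unfolding normal_form_def order_smult[OF assms(2)] order_mult[OF nz] order_prod_linear[OF assms(1)]
    by (simp only:)
qed

lemma degree_normal_form:
  assumes "finite Z" "K \<noteq> 0"
  shows "degree (normal_form K p Z m) = m + card Z"
  using assms unfolding normal_form_def
  by (simp add: degree_mult_eq degree_linear_power degree_prod_eq_sum_degree del: mult_pCons_left)

text \<open>The number \<open>card (E - {p})\<close> is 2 if \<open>p\<close> is a vertex and 3
  otherwise. By \<open>pell_root_order\<close> this is also the multiplicity of a zero at
  \<open>p\<close>, so one number serves both purposes.\<close>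

lemma card_Diff_center:
  assumes "card E = 3"
  shows "card (E - {p}) + of_bool (p \<in> E) = 3" "finite E" "0 < card (E - {p})"
proof -
  show "finite E" using assms by (metis card.infinite zero_neq_numeral)
  then show "card (E - {p}) + of_bool (p \<in> E) = 3" "0 < card (E - {p})"
    using assms by (auto simp: card_Diff_singleton_if)
qed

text \<open>The multiplicities of the zeros are forced, so only the leading coefficient and the set
  of vertices at which \<open>r\<close> vanishes remain free.\<close>

lemma pell_normal_form:
  assumes "card E = 3" "pell E p r" "poly r p = 0" "\<And>s. poly r s = 0 \<Longrightarrow> s \<in> insert p E"
  shows "\<exists>K Z. K \<noteq> 0 \<and> Z \<subseteq> E - {p} \<and> r = normal_form K p Z (card (E - {p}))"
proof -
  note card = card_Diff_center(1)[OF assms(1), of p] card_Diff_center(2)[OF assms(1)]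
    card_Diff_center(3)[OF assms(1), of p]
  define Z where "Z = {e \<in> E - {p}. poly r e = 0}"
  have fin: "finite Z" using card(2) by (simp add: Z_def)
  have r0: "r \<noteq> 0" using assms(2) nonconstant_nonzero by (auto simp: pell_def)
  have "r = smult (lead_coeff r) (\<Prod>s\<in>insert p Z. [:-s, 1:] ^ order s r)"
    using assms(4) r0 fin by (intro complex_poly_prod_order[symmetric]) (auto simp: Z_def)
  also have "(\<Prod>s\<in>insert p Z. [:-s, 1:] ^ order s r) =
      [:-p, 1:] ^ order p r * (\<Prod>s\<in>Z. [:-s, 1:] ^ order s r)"
    using fin by (intro prod.insert) (auto simp: Z_def)
  also have "order p r = card (E - {p})"
    using pell_root_order(1)[OF card(2) assms(2,3)] card(1) by simp
  also have "(\<Prod>s\<in>Z. [:-s, 1:] ^ order s r) = (\<Prod>s\<in>Z. [:-s, 1:])"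
  proof (rule prod.cong)
    fix s assume "s \<in> Z"
    then have "order s r = 1"
      using pell_root_order(1)[OF card(2) assms(2), of s] by (auto simp: Z_def)
    then show "[:-s, 1:] ^ order s r = [:-s, 1:]" by simp
  qed simp
  finally have "r = normal_form (lead_coeff r) p Z (card (E - {p}))"
    unfolding normal_form_def .
  moreover have "Z \<subseteq> E - {p}" "lead_coeff r \<noteq> 0" using r0 by (auto simp: Z_def)
  ultimately show ?thesis by blast
qed

text \<open>At a zero of \<open>r\<close> only \<open>C\<close> enters, at a zero of
  \<open>r - 1\<close> only \<open>C'\<close>. Away from the vertices and \<open>p\<close>, a
  condition arises only where \<open>r\<close> takes the value 1, which it does doubly. A degree
  count shows that there are \<open>card Z\<close> such points, so \<open>C' = 0\<close> is forced
  by them precisely if \<open>Z\<close> is nonempty.\<close>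

lemma balanced_normal_form_iff:
  assumes "card E = 3" "K \<noteq> 0" "Z \<subseteq> E - {p}"
    and r: "r = normal_form K p Z (card (E - {p}))" and pell: "pell E p r"
  shows "balanced E \<kappa> p r C C' \<longleftrightarrow> (Z \<noteq> {} \<longrightarrow> C' = 0) \<and>
    of_nat (card (E - {p})) * C = of_bool (p \<in> E) * (\<kappa> p - 1/2) + 1/2 \<and>
    (\<forall>e\<in>Z. C = \<kappa> e - 1/2) \<and> (\<forall>e\<in>E - {p} - Z. C' = \<kappa> e - 1/2)"
proof -
  define m where "m = card (E - {p})"
  note card = card_Diff_center(1)[OF assms(1), of p, folded m_def] card_Diff_center(2)[OF assms(1)]
    card_Diff_center(3)[OF assms(1), of p, folded m_def]
  have fin: "finite Z" using finite_subset[OF assms(3)] card(2) by blast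
  have nz: "r \<noteq> 0" "r - 1 \<noteq> 0" using pell nonconstant_nonzero by (auto simp: pell_def)
  have ord: "order s r = (if s = p then m else 0) + of_bool (s \<in> Z)" for s
    unfolding r m_def by (rule order_normal_form[OF fin assms(2)])
  have root: "poly r s = 0 \<longleftrightarrow> s = p \<or> s \<in> Z" for s
    using ord[of s] nz(1) card(3) by (auto simp: order_root)
  have ord1_root: "order s (r - 1) = 0" if "s = p \<or> s \<in> Z" for s
  proof -
    have "poly r s = 0" using root that by blast
    then show ?thesis by (intro order_0I) simp
  qed
  have ord1_vertex: "order s (r - 1) = 1" if "s \<in> E - {p} - Z" for s
  proof -
    have "poly r s = 1" using pell_value[OF card(2) pell, of s] root that by auto
    then show ?thesis using pell_root_order(2)[OF card(2) pell, of s] that by auto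
  qed
  have ord1_other: "order s (r - 1) = 2" if "poly r s = 1" "s \<notin> insert p E" for s
    using pell_root_order(2)[OF card(2) pell that(1)] that(2) by auto
  have "degree (r + - 1) = degree r"
    using pell by (intro degree_add_eq_left) (auto simp: pell_def)
  then have deg: "degree (r - 1) = m + card Z"
    using degree_normal_form[OF fin assms(2)] by (simp add: r m_def)
  have cardZ: "card (E - {p} - Z) = m - card Z"
    unfolding m_def using assms(3) fin by (simp add: card_Diff_subset)
  define G where "G = {s. poly r s = 1 \<and> s \<notin> insert p E}"
  have finG: "finite G"
  proof (rule finite_subset)
    show "G \<subseteq> {s. poly (r - 1) s = 0}" by (auto simp: G_def)
    show "finite {s. poly (r - 1) s = 0}" using nz(2) by (rule poly_roots_finite)
  qed
  \<comment> \<open>The degree of \<open>r - 1\<close> is counted by its zeros: a simple one at each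
    vertex outside \<open>insert p Z\<close> and a double one at each point of
    \<open>G\<close>.\<close>
  have "m + card Z = (\<Sum>s\<in>(E - {p} - Z) \<union> G. order s (r - 1))"
    unfolding deg[symmetric]
  proof (rule degree_eq_sum_order[OF _ _ nz(2)])
    fix s assume "poly (r - 1) s = 0"
    then have "poly r s = 1" "\<not> (s = p \<or> s \<in> Z)" using root[of s] by auto
    then show "s \<in> (E - {p} - Z) \<union> G" by (auto simp: G_def)
  qed (use finG card(2) in auto)
  also have "\<dots> = (\<Sum>s\<in>E - {p} - Z. order s (r - 1)) + (\<Sum>s\<in>G. order s (r - 1))"
    using finG card(2) by (intro sum.union_disjoint) (auto simp: G_def)
  also have "(\<Sum>s\<in>E - {p} - Z. order s (r - 1)) = m - card Z"
    using ord1_vertex cardZ by simp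
  also have "(\<Sum>s\<in>G. order s (r - 1)) = 2 * card G"
    using ord1_other by (simp add: G_def)
  finally have cardG: "m + card Z = m - card Z + 2 * card G" .
  moreover have "card Z \<le> m"
    unfolding m_def using assms(3) card(2) by (intro card_mono) auto
  ultimately have "card G = card Z" by linarith
  then have G: "G = {} \<longleftrightarrow> Z = {}"
    using fin finG by (metis card_eq_0_iff card.empty)
  \<comment> \<open>The balance condition at a single point. It is examined separately at
    \<open>p\<close>, on \<open>Z\<close>, at the other vertices, on \<open>G\<close> and at the
    remaining points.\<close>
  define good where "good s \<longleftrightarrow> C * of_nat (order s r) + C' * of_nat (order s (r - 1)) =
     of_bool (s \<in> E) * (\<kappa> s - 1/2) + of_bool (s = p) / 2" for s
  have good_p: "good p \<longleftrightarrow> of_nat m * C = of_bool (p \<in> E) * (\<kappa> p - 1/2) + 1/2"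
    using ord[of p] ord1_root[of p] assms(3) by (auto simp: good_def mult.commute)
  have good_Z: "good e \<longleftrightarrow> C = \<kappa> e - 1/2" if "e \<in> Z" for e
    using that ord[of e] ord1_root[of e] assms(3) by (auto simp: good_def)
  have good_E: "good e \<longleftrightarrow> C' = \<kappa> e - 1/2" if "e \<in> E - {p} - Z" for e
    using that ord[of e] ord1_vertex[of e] by (auto simp: good_def)
  have good_G: "good s \<longleftrightarrow> C' = 0" if "s \<in> G" for s
    using that ord[of s] ord1_other[of s] assms(3) by (auto simp: good_def G_def)
  have good_other: "good s" if "s \<notin> insert p E" "s \<notin> G" for s
  proof -
    have "order s (r - 1) = 0" "order s r = 0"
      using that root assms(3) by (auto intro!: order_0I simp: G_def)
    then show ?thesis using that by (auto simp: good_def)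
  qed
  have "(\<forall>s. good s) \<longleftrightarrow> good p \<and> (\<forall>s\<in>Z. good s) \<and> (\<forall>s\<in>E - {p} - Z. good s) \<and> (\<forall>s\<in>G. good s)"
  proof
    assume *: "good p \<and> (\<forall>s\<in>Z. good s) \<and> (\<forall>s\<in>E - {p} - Z. good s) \<and> (\<forall>s\<in>G. good s)"
    show "\<forall>s. good s"
    proof
      fix s
      consider "s = p" | "s \<in> Z" | "s \<in> E - {p} - Z" | "s \<in> G" | "s \<notin> insert p E" "s \<notin> G"
        by auto
      then show "good s" using * good_other by cases auto
    qed
  qed simp
  also have "(\<forall>s\<in>Z. good s) \<longleftrightarrow> (\<forall>e\<in>Z. C = \<kappa> e - 1/2)"
    using good_Z by (rule ball_cong[OF refl])
  also have "(\<forall>s\<in>E - {p} - Z. good s) \<longleftrightarrow> (\<forall>e\<in>E - {p} - Z. C' = \<kappa> e - 1/2)"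
    using good_E by (rule ball_cong[OF refl])
  also have "(\<forall>s\<in>G. good s) \<longleftrightarrow> (Z \<noteq> {} \<longrightarrow> C' = 0)"
    using good_G G by (metis all_not_in_conv)
  finally have "(\<forall>s. good s) \<longleftrightarrow> (Z \<noteq> {} \<longrightarrow> C' = 0) \<and>
      of_nat m * C = of_bool (p \<in> E) * (\<kappa> p - 1/2) + 1/2 \<and>
      (\<forall>e\<in>Z. C = \<kappa> e - 1/2) \<and> (\<forall>e\<in>E - {p} - Z. C' = \<kappa> e - 1/2)"
    unfolding good_p by (simp only: conj_ac)
  then show ?thesis
    unfolding balanced_def good_def m_def .
qed

text \<open>A zero of \<open>r\<close> and a zero of \<open>r - 1\<close>, both away from the
  vertices and \<open>p\<close>, would force \<open>C = C' = 0\<close>. The condition at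
  \<open>p\<close> would then read \<open>\<kappa> p = 0\<close> for a vertex and
  \<open>1/2 = 0\<close> otherwise. So one of \<open>r\<close> and \<open>1 - r\<close> has all its
  zeros among the vertices and \<open>p\<close>; it remains to arrange that it vanishes at
  \<open>p\<close>.\<close>

lemma reducing_cases:
  assumes "card E = 3" "reducing E \<kappa> p r" "p \<in> E \<longrightarrow> \<kappa> p \<noteq> 0"
  shows "\<exists>S K Z. (S = r \<or> S = 1 - r) \<and> reducing E \<kappa> p S \<and>
    K \<noteq> 0 \<and> Z \<subseteq> E - {p} \<and> S = normal_form K p Z (card (E - {p}))"
proof -
  define m where "m = card (E - {p})"
  note card = card_Diff_center(1)[OF assms(1), of p, folded m_def] card_Diff_center(2)[OF assms(1)]
    card_Diff_center(3)[OF assms(1), of p, folded m_def]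
  have side: "\<exists>S. (S = r \<or> S = 1 - r) \<and> (\<forall>s. poly S s = 0 \<longrightarrow> s \<in> insert p E)"
  proof (rule ccontr)
    assume no: "\<not> ?thesis"
    then obtain s where s: "poly r s = 0" "s \<notin> insert p E" by blast
    from no obtain t where t: "poly r t = 1" "t \<notin> insert p E" by fastforce
    obtain C C' where pell: "pell E p r" and bal: "balanced E \<kappa> p r C C'"
      using assms(2) by (auto simp: reducing_def)
    have "order s r = 2" "order s (r - 1) = 0"
      using pell_root_order(1)[OF card(2) pell s(1)] s by (auto intro: order_0I)
    then have "C = 0" using bal s(2) unfolding balanced_def by (auto dest: spec[of _ s])
    moreover have "order t (r - 1) = 2" "order t r = 0"
      using pell_root_order(2)[OF card(2) pell t(1)] t by (auto intro: order_0I)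
    then have "C' = 0" using bal t(2) unfolding balanced_def by (auto dest: spec[of _ t])
    ultimately have "of_bool (p \<in> E) * (\<kappa> p - 1/2) + 1/2 = 0"
      using spec[OF bal[unfolded balanced_def], of p] by simp
    then show False using assms(3) by (cases "p \<in> E") auto
  qed
  then obtain S where S: "S = r \<or> S = 1 - r" and roots: "\<And>s. poly S s = 0 \<Longrightarrow> s \<in> insert p E"
    by blast
  have redS: "reducing E \<kappa> p S" using S assms(2) reducing_complement by auto
  then have pell: "pell E p S" by (simp add: reducing_def)
  have nz: "S \<noteq> 0" "S - 1 \<noteq> 0" using pell nonconstant_nonzero by (auto simp: pell_def)
  \<comment> \<open>If \<open>p\<close> is a vertex and \<open>S\<close> takes neither value there,
    both orders vanish and the balance condition at \<open>p\<close> again gives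
    \<open>\<kappa> p = 0\<close>.\<close>
  have val: "poly S p = 0 \<or> poly S p = 1"
  proof (cases "p \<in> E")
    case False
    then show ?thesis using pell_value[OF card(2) pell, of p] by simp
  next
    case True
    show ?thesis
    proof (rule ccontr)
      assume "\<not> ?thesis"
      then have "order p S = 0" "order p (S - 1) = 0" by (auto intro: order_0I)
      moreover obtain C C' where "balanced E \<kappa> p S C C'" using redS by (auto simp: reducing_def)
      ultimately have "\<kappa> p - 1/2 + 1/2 = 0"
        using True unfolding balanced_def by (auto dest: spec[of _ p])
      then show False using assms(3) True by simp
    qed
  qed
  have "\<exists>S. (S = r \<or> S = 1 - r) \<and> poly S p = 0 \<and> (\<forall>s. poly S s = 0 \<longrightarrow> s \<in> insert p E)"
  proof (cases "poly S p = 0")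
    case True
    then show ?thesis using S roots by blast
  next
    case False
    \<comment> \<open>Now all zeros of \<open>S\<close> are simple and lie at vertices, so its
      degree is at most \<open>m\<close>. But \<open>S - 1\<close> has a zero of order
      \<open>m\<close> at \<open>p\<close>, hence no other zero, and \<open>1 - S\<close> can
      replace \<open>S\<close>.\<close>
    then have p1: "poly S p = 1" using val by simp
    have "degree (S + - 1) = degree S"
      using pell by (intro degree_add_eq_left) (auto simp: pell_def)
    then have deg: "degree (S - 1) = degree S" by simp
    have "degree S = (\<Sum>s\<in>E - {p}. order s S)"
    proof (rule degree_eq_sum_order[OF _ _ nz(1)])
      fix s assume "poly S s = 0"
      then show "s \<in> E - {p}" using roots[of s] p1 by auto
    qed (use card(2) in auto)
    also have "\<dots> \<le> (\<Sum>s\<in>E - {p}. 1)"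
    proof (rule sum_mono)
      fix s assume "s \<in> E - {p}"
      then show "order s S \<le> 1"
        using pell_root_order(1)[OF card(2) pell, of s] order_0I[of S s] by (cases "poly S s = 0") auto
    qed
    finally have degS: "degree S \<le> m" by (simp add: m_def)
    have ordp: "order p (S - 1) = m"
      using pell_root_order(2)[OF card(2) pell p1] card(1) by simp
    have "s = p" if "poly (S - 1) s = 0" for s
    proof (rule ccontr)
      assume "s \<noteq> p"
      have fin: "finite {x. poly (S - 1) x = 0}" using nz(2) by (rule poly_roots_finite)
      have "(\<Sum>x\<in>{p, s}. order x (S - 1)) \<le> (\<Sum>x | poly (S - 1) x = 0. order x (S - 1))"
        using fin that p1 by (intro sum_mono2) auto
      also have "\<dots> = degree (S - 1)"
        using fin nz(2) by (intro degree_eq_sum_order[symmetric]) auto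
      finally have "m + order s (S - 1) \<le> m"
        using ordp degS deg \<open>s \<noteq> p\<close> by simp
      then have "order s (S - 1) = 0" by simp
      then show False using that nz(2) by (metis order_root)
    qed
    then have "\<forall>s. poly (1 - S) s = 0 \<longrightarrow> s \<in> insert p E" by simp
    moreover have "poly (1 - S) p = 0" using p1 by simp
    moreover have "1 - S = r \<or> 1 - S = 1 - r" using S by auto
    ultimately show ?thesis by blast
  qed
  then obtain S where S: "S = r \<or> S = 1 - r" "poly S p = 0"
    and roots: "\<And>s. poly S s = 0 \<Longrightarrow> s \<in> insert p E"
    by blast
  have redS: "reducing E \<kappa> p S" using S assms(2) reducing_complement by auto
  then have "pell E p S" by (simp add: reducing_def)
  from pell_normal_form[OF assms(1) this S(2) roots] redS S(1) show ?thesis by blast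
qed

section \<open>Affine normalization\<close>

text \<open>The affine coordinate in which \<open>x\<close> becomes 0 and \<open>y\<close> becomes
  1.\<close>

definition affine_coord :: "complex \<Rightarrow> complex \<Rightarrow> complex poly" where
  "affine_coord x y = smult (1 / (y - x)) [:-x, 1:]"

lemma affine_coord:
  assumes "x \<noteq> y"
  shows "degree (affine_coord x y) = 1" "poly (affine_coord x y) t = (t - x) / (y - x)"
    "inj (poly (affine_coord x y))"
proof -
  show "degree (affine_coord x y) = 1" using assms by (simp add: affine_coord_def)
  have p: "poly (affine_coord x y) t = (t - x) / (y - x)" for t
    by (simp add: affine_coord_def diff_divide_distrib)
  show "poly (affine_coord x y) t = (t - x) / (y - x)" by (rule p)
  show "inj (poly (affine_coord x y))" using assms by (simp add: inj_def p)
qed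

text \<open>Exchanging the base points reflects the coordinate in 1/2; this later moves
  \<open>p\<close> from the position \<open>1 - p\<^sub>0\<close> to
  \<open>p\<^sub>0\<close>.\<close>

lemma affine_coord_swap:
  assumes "x \<noteq> y"
  shows "poly (affine_coord y x) t = 1 - poly (affine_coord x y) t"
  using assms by (simp add: affine_coord field_simps)

lemma normal_form_pcompose:
  assumes "x \<noteq> y"
  defines "A \<equiv> affine_coord x y"
  shows "pcompose (normal_form K (poly A p) (poly A ` Z) m) A = normal_form (K / (y - x) ^ (m + card Z)) p Z m"
proof -
  have lin: "pcompose [:-poly A t, 1:] A = smult (1 / (y - x)) [:-t, 1:]" for t
    using assms(1) by (simp add: A_def affine_coord_def pcompose_pCons diff_divide_distrib)
  have inj: "inj_on (poly A) Z"
    using affine_coord(3)[OF assms(1)] unfolding A_def by (rule inj_on_subset) simp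
  show ?thesis
    unfolding normal_form_def
    by (simp add: pcompose_smult pcompose_mult pcompose_power pcompose_prod prod.reindex[OF inj] o_def
        lin smult_power prod_smult power_add power_divide mult.commute del: mult_pCons_left smult_pCons)
qed

lemma inverse_affine_coord:
  assumes "x \<noteq> y"
  shows "pcompose (affine_coord x y) [:x, y - x:] = [:0, 1:]" "pcompose [:x, y - x:] (affine_coord x y) = [:0, 1:]"
  using assms by (simp_all add: affine_coord_def pcompose_pCons pcompose_smult)

text \<open>Since \<open>pell_pcompose\<close> pulls back along an affine map, it is applied to the
  inverse of \<open>A\<close>. Each linear factor contributes one factor \<open>y - x\<close> to the
  new leading coefficient.\<close>

lemma pell_affine_coord:
  assumes "x \<noteq> y" "card E = 3" "pell E p (normal_form K p Z m)"
  defines "A \<equiv> affine_coord x y"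
  shows "pell (poly A ` E) (poly A p) (normal_form (K * (y - x) ^ (m + card Z)) (poly A p) (poly A ` Z) m)"
proof -
  let ?B = "[:x, y - x:]"
  let ?N = "normal_form (K * (y - x) ^ (m + card Z)) (poly A p) (poly A ` Z) m"
  have B: "poly ?B (poly A t) = t" for t
    using assms(1) by (simp add: A_def affine_coord)
  have "pcompose ?N A = normal_form K p Z m"
    using normal_form_pcompose[OF assms(1)] assms(1) by (simp add: A_def)
  then have "pcompose (normal_form K p Z m) ?B = pcompose (pcompose ?N A) ?B" by simp
  also have "\<dots> = ?N"
    by (simp only: pcompose_assoc[symmetric] A_def inverse_affine_coord(1)[OF assms(1)] pcompose_idR)
  finally have N: "pcompose (normal_form K p Z m) ?B = ?N" .
  have inj: "inj_on (poly A) E"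
    using affine_coord(3)[OF assms(1)] unfolding A_def by (rule inj_on_subset) simp
  have "poly ?B ` (poly A ` E) = E" by (simp only: image_image B image_ident)
  then have "pell (poly A ` E) (poly A p) (pcompose (normal_form K p Z m) ?B)"
    using assms(1,2,3) by (intro pell_pcompose) (simp_all only: B card_image[OF inj], simp_all)
  then show ?thesis unfolding N .
qed

text \<open>The format of the subcases, freed from the parametrization of the Heun equation.\<close>

definition subcase_of ::
  "complex set \<Rightarrow> (complex \<Rightarrow> complex) \<Rightarrow> complex \<Rightarrow> complex poly \<Rightarrow>
   complex \<Rightarrow> complex \<Rightarrow> ((complex \<Rightarrow> complex) \<Rightarrow> bool) \<Rightarrow> complex poly \<Rightarrow> bool" where
  "subcase_of E \<kappa> p r D p\<^sub>0 restr P \<longleftrightarrow>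
     (\<exists>A. degree A = 1 \<and> poly A ` E = {0, 1, D} \<and> poly A p = p\<^sub>0 \<and>
       restr (\<lambda>x. \<kappa> (inv (poly A) x)) \<and> (r = pcompose P A \<or> 1 - r = pcompose P A))"

lemma reduction_subcase_iff:
  "reduction_subcase d p \<gamma> \<delta> \<epsilon> (to_fract r) D p\<^sub>0 restr P \<longleftrightarrow>
   subcase_of {0, 1, d} (exponent_param \<gamma> \<delta> \<epsilon>) p r D p\<^sub>0 restr P"
proof -
  have "1 - to_fract r = to_fract (1 - r)" by simp
  then show ?thesis
    unfolding reduction_subcase_def subcase_of_def similar_triangles_def affine_triangle_map_def
    by (auto simp only: to_fract_eq_iff)
qed

lemma inj_degree1:
  fixes A :: "complex poly"
  assumes "degree A = 1"
  shows "inj (poly A)"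
proof -
  obtain n m where "A = [:n, m:]" "m \<noteq> 0" using assms by (metis degree1_coeffs)
  then show ?thesis by (auto simp: inj_on_def)
qed

text \<open>The common frame for the necessity of a subcase. The coordinate sends \<open>x\<close>
  and \<open>y\<close> to 0 and 1 and \<open>z\<close> to some \<open>D'\<close> not known in
  advance. The last hypothesis solves the Pell equation in this coordinate, which yields
  \<open>D' = D\<close> and identifies the polynomial. \<open>Z'\<close> gives the vertices that are
  zeros in terms of the image of \<open>z\<close>.\<close>

lemma subcase_of_normal_form:
  assumes dist: "x \<noteq> y" "z \<noteq> x" "z \<noteq> y" and E: "E = {x, y, z}" and K: "K \<noteq> 0"
    and r: "r = normal_form K p Z m" "pell E p r" "r = S \<or> r = 1 - S"
    and A: "A = affine_coord x y" "poly A p = p\<^sub>0" "poly A ` Z = Z' (poly A z)"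
    and restr: "\<And>\<kappa>'. \<kappa>' 0 = \<kappa> x \<Longrightarrow> \<kappa>' 1 = \<kappa> y \<Longrightarrow> \<kappa>' D = \<kappa> z \<Longrightarrow> restr \<kappa>'"
    and P: "\<And>K' D'. K' \<noteq> 0 \<Longrightarrow> D' \<noteq> 0 \<Longrightarrow> D' \<noteq> 1 \<Longrightarrow>
      pell {0, 1, D'} p\<^sub>0 (normal_form K' p\<^sub>0 (Z' D') m) \<Longrightarrow>
      D' = D \<and> (P = normal_form K' p\<^sub>0 (Z' D) m \<or> 1 - P = normal_form K' p\<^sub>0 (Z' D) m)"
  shows "subcase_of E \<kappa> p S D p\<^sub>0 restr P"
  unfolding subcase_of_def
proof (intro exI[of _ A] conjI)
  define K' where "K' = K * (y - x) ^ (m + card Z)"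
  define N where "N = normal_form K' p\<^sub>0 (Z' (poly A z)) m"
  have K': "K' \<noteq> 0" using K dist by (simp add: K'_def)
  show deg: "degree A = 1" using affine_coord(1)[OF dist(1)] A by simp
  have inj: "inj (poly A)" using affine_coord(3)[OF dist(1)] A by simp
  have xy: "poly A x = 0" "poly A y = 1" using dist(1) A by (simp_all add: affine_coord)
  then have z: "poly A z \<noteq> 0" "poly A z \<noteq> 1" using inj dist(2,3) by (metis injD)+
  have AE: "poly A ` E = {0, 1, poly A z}" using E xy by simp
  have card: "card E = 3" using E dist by auto
  have "pell {0, 1, poly A z} p\<^sub>0 N"
    using pell_affine_coord[OF dist(1) card, of p K Z m] r(1,2) AE A by (simp add: N_def K'_def)
  from P[OF K' z this[unfolded N_def]] have D: "poly A z = D" and PN: "P = N \<or> 1 - P = N"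
    by (auto simp: N_def)
  show "poly A ` E = {0, 1, D}" using AE D by simp
  show "poly A p = p\<^sub>0" by fact
  show "restr (\<lambda>x. \<kappa> (inv (poly A) x))" using inj xy D
    by (intro restr) (metis inv_f_f)+
  have "pcompose N A = r"
    using normal_form_pcompose[OF dist(1), of K' p Z m] dist(1) r(1) A by (simp add: N_def K'_def)
  have "r = pcompose P A \<or> r = 1 - pcompose P A"
    using PN
  proof
    assume "P = N"
    then show ?thesis using \<open>pcompose N A = r\<close> by simp
  next
    assume N': "1 - P = N"
    have "pcompose N A = 1 - pcompose P A"
      unfolding N'[symmetric] by (simp only: pcompose_diff pcompose_1)
    then show ?thesis using \<open>pcompose N A = r\<close> by simp
  qed
  then have "r = pcompose P A \<or> 1 - r = pcompose P A" by (elim disjE) simp_all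
  then show "S = pcompose P A \<or> 1 - S = pcompose P A"
    using r(3) by (elim disjE) simp_all
qed

text \<open>The Pell equation fixes the position of \<open>p\<close> only up to the reflection of
  \<open>p\<^sub>0\<close> in 1/2. In the reflected case \<open>x\<close> and \<open>y\<close> are
  exchanged, so the hypotheses on the zero set and the exponents cover both orders.\<close>

lemma subcase_of_normal_form_up_to_conjugation:
  assumes dist: "x \<noteq> y" "z \<noteq> x" "z \<noteq> y" and E: "E = {x, y, z}" and K: "K \<noteq> 0"
    and r: "r = normal_form K p Z m" "pell E p r" "r = S \<or> r = 1 - S"
    and Z: "\<And>x' y'. {x', y'} = {x, y} \<Longrightarrow> poly (affine_coord x' y') ` Z = Z' (poly (affine_coord x' y') z)"
    and restr: "\<And>x' y' \<kappa>'. {x', y'} = {x, y} \<Longrightarrow>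
      \<kappa>' 0 = \<kappa> x' \<Longrightarrow> \<kappa>' 1 = \<kappa> y' \<Longrightarrow> \<kappa>' D = \<kappa> z \<Longrightarrow> restr \<kappa>'"
    and p\<^sub>0: "\<And>K' D' p'. K' \<noteq> 0 \<Longrightarrow> D' \<noteq> 0 \<Longrightarrow> D' \<noteq> 1 \<Longrightarrow>
      pell {0, 1, D'} p' (normal_form K' p' (Z' D') m) \<Longrightarrow> p' = p\<^sub>0 \<or> p' = 1 - p\<^sub>0"
    and P: "\<And>K' D'. K' \<noteq> 0 \<Longrightarrow> D' \<noteq> 0 \<Longrightarrow> D' \<noteq> 1 \<Longrightarrow>
      pell {0, 1, D'} p\<^sub>0 (normal_form K' p\<^sub>0 (Z' D') m) \<Longrightarrow>
      D' = D \<and> (P = normal_form K' p\<^sub>0 (Z' D) m \<or> 1 - P = normal_form K' p\<^sub>0 (Z' D) m)"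
  shows "subcase_of E \<kappa> p S D p\<^sub>0 restr P"
proof -
  let ?A = "affine_coord x y"
  have xy: "poly ?A x = 0" "poly ?A y = 1" using dist(1) by (simp_all add: affine_coord)
  then have z: "poly ?A z \<noteq> 0" "poly ?A z \<noteq> 1"
    using affine_coord(3)[OF dist(1)] dist(2,3) by (metis injD)+
  have card: "card E = 3" using E dist by auto
  have "pell {0, 1, poly ?A z} (poly ?A p)
      (normal_form (K * (y - x) ^ (m + card Z)) (poly ?A p) (Z' (poly ?A z)) m)"
    using pell_affine_coord[OF dist(1) card, of p K Z m] r(1,2) E xy Z[OF refl] by simp
  from p\<^sub>0[OF _ z this] K dist(1) have "poly ?A p = p\<^sub>0 \<or> poly ?A p = 1 - p\<^sub>0" by simp
  then consider "poly ?A p = p\<^sub>0" | "poly (affine_coord y x) p = p\<^sub>0"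
    using affine_coord_swap[OF dist(1)] by auto
  then show ?thesis
  proof cases
    case 1
    show ?thesis
      by (rule subcase_of_normal_form[OF dist E K r refl 1 Z[OF refl] restr[OF refl] P])
  next
    case 2
    have swap: "{y, x} = {x, y}" "E = {y, x, z}" using E by auto
    show ?thesis
      by (rule subcase_of_normal_form[OF dist(1)[symmetric] dist(3,2) swap(2) K r refl 2 Z[OF swap(1)] restr[OF swap(1)] P])
  qed
qed

lemma reducing_normal_form:
  assumes "card E = 3" "K \<noteq> 0" "Z \<subseteq> E - {p}" "pell E p (normal_form K p Z m)" "m = card (E - {p})"
    "Z \<noteq> {} \<longrightarrow> C' = 0" "of_nat m * C = of_bool (p \<in> E) * (\<kappa> p - 1/2) + 1/2"
    "\<forall>e\<in>Z. C = \<kappa> e - 1/2" "\<forall>e\<in>E - {p} - Z. C' = \<kappa> e - 1/2"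
  shows "reducing E \<kappa> p (normal_form K p Z m)"
  using balanced_normal_form_iff[OF assms(1-3) refl assms(4)[unfolded assms(5)], of \<kappa> C C'] assms(4-9)
  unfolding reducing_def by blast

text \<open>The reduction on the normalized triangle is pulled back along \<open>A\<close>. The
  equality of value sets serves those restrictions that are stated through \<open>\<kappa>\<close>
  on \<open>E\<close> instead of \<open>\<kappa>'\<close>.\<close>

lemma reducing_if_subcase_of:
  assumes "subcase_of E \<kappa> p r D p\<^sub>0 restr P" "card E = 3"
    "\<And>\<kappa>'. restr \<kappa>' \<Longrightarrow> \<kappa>' ` {0, 1, D} = \<kappa> ` E \<Longrightarrow> reducing {0, 1, D} \<kappa>' p\<^sub>0 P"
  shows "reducing E \<kappa> p r"
proof -
  from assms(1) obtain A where A: "degree A = 1" "poly A ` E = {0, 1, D}" "poly A p = p\<^sub>0"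
    "restr (\<lambda>x. \<kappa> (inv (poly A) x))" and r: "r = pcompose P A \<or> 1 - r = pcompose P A"
    by (auto simp: subcase_of_def)
  have inv: "inv (poly A) (poly A x) = x" for x using inj_degree1[OF A(1)] by simp
  have "(\<lambda>x. \<kappa> (inv (poly A) x)) ` {0, 1, D} = \<kappa> ` E"
    unfolding A(2)[symmetric] by (simp add: image_image inv)
  from assms(3)[OF A(4) this] have "reducing {0, 1, D} (\<lambda>x. \<kappa> (inv (poly A) x)) p\<^sub>0 P" .
  then have "reducing E \<kappa> p (pcompose P A)"
    using reducing_pcompose[OF A(1) assms(2), of "\<lambda>x. \<kappa> (inv (poly A) x)" p P] by (simp add: A(2,3) inv)
  then show ?thesis
    using r reducing_complement[of E \<kappa> p "1 - r"] by auto
qed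

section \<open>The subcases\<close>

lemma pell_normal_form_1a:
  assumes "K \<noteq> 0" "D \<noteq> 0" "D \<noteq> 1"
  shows "pell {0, 1, D} 1 (normal_form K 1 {} 2) \<longleftrightarrow> D = 2 \<and> K = 1"
  unfolding pell_normal_1a[OF assms, symmetric] by (simp add: normal_form_def)

lemma pell_normal_form_1b:
  assumes "K \<noteq> 0" "D \<noteq> 0" "D \<noteq> 1"
  shows "pell {0, 1, D} 1 (normal_form K 1 {D} 2) \<longleftrightarrow> D = 4 \<and> K = -1/4"
  unfolding pell_normal_1b[OF assms, symmetric] by (simp add: normal_form_def)

lemma pell_normal_form_1c:
  assumes "K \<noteq> 0" "D \<noteq> 0" "D \<noteq> 1"
  shows "pell {0, 1, D} 1 (normal_form K 1 {0, D} 2) \<longleftrightarrow> D = 2 \<and> K = -4"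
  unfolding pell_normal_1c[OF assms, symmetric] using assms
  by (simp add: normal_form_def mult.assoc del: mult_pCons_left mult_pCons_right smult_pCons)

lemma pell_normal_form_2a:
  assumes "K \<noteq> 0" "D \<noteq> 0" "D \<noteq> 1"
  shows "pell {0, 1, D} p (normal_form K p {} 3) \<longleftrightarrow> 1 + D = 3 * p \<and> D = 3 * p\<^sup>2 \<and> K * p ^ 3 = -1"
  unfolding pell_normal_2a[OF assms, symmetric] by (simp add: normal_form_def)

lemma pell_normal_form_2b:
  assumes "K \<noteq> 0" "D \<noteq> 0" "D \<noteq> 1"
  shows "pell {0, 1, D} p (normal_form K p {D} 3) \<longleftrightarrow>
    D = 5 * p - 2 \<and> 8 * p\<^sup>2 - 8 * p + 3 = 0 \<and> K * D * p ^ 3 = 1"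
  unfolding pell_normal_2b[OF assms, symmetric] by (simp add: normal_form_def)

lemma pell_normal_form_2c:
  assumes "K \<noteq> 0" "D \<noteq> 0" "D \<noteq> 1"
  shows "pell {0, 1, D} p (normal_form K p {0, 1} 3) \<longleftrightarrow>
    5 * D = 11 * p - 3 \<and> 27 * p\<^sup>2 - 27 * p + 8 = 0 \<and> K * D * p\<^sup>2 = 25"
  unfolding pell_normal_2c[OF assms, symmetric]
  by (simp add: normal_form_def mult.assoc del: mult_pCons_left mult_pCons_right smult_pCons)

lemma pell_normal_form_2d:
  assumes "K \<noteq> 0" "D \<noteq> 0" "D \<noteq> 1"
  shows "pell {0, 1, D} p (normal_form K p {0, 1, D} 3) \<longleftrightarrow> 1 + D = 3 * p \<and> D = 3 * p\<^sup>2 \<and> K * p ^ 6 = -4"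
  unfolding pell_normal_2d[OF assms, symmetric] using assms
  by (simp add: normal_form_def mult.assoc del: mult_pCons_left mult_pCons_right smult_pCons)

text \<open>The listed polynomial takes the value 1 at the position of \<open>p\<close>, so its
  complement is the one in normal form. The same happens for two of the polynomials below.\<close>

lemma normal_form_1a: "1 - [:0, 1:] * (2 - [:0, 1:]) = normal_form 1 1 {} 2"
  unfolding poly_eq_poly_eq_iff[symmetric] fun_eq_iff
  by (simp add: normal_form_def power2_eq_square algebra_simps)

lemma normal_form_1b: "([:0, 1:] - 1)\<^sup>2 * (1 - smult (1/4) [:0, 1:]) = normal_form (-1/4) 1 {4} 2"
  unfolding poly_eq_poly_eq_iff[symmetric] fun_eq_iff
  by (simp add: normal_form_def power2_eq_square field_simps)

lemma normal_form_1c: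
  "1 - 4 * ([:0, 1:] * (2 - [:0, 1:]) - [:1/2:])\<^sup>2 = normal_form (-4) 1 {0, 2} 2"
  unfolding poly_eq_poly_eq_iff[symmetric] fun_eq_iff
  by (simp add: normal_form_def power2_eq_square field_simps)

lemma normal_form_2a:
  assumes "K * p ^ 3 = -1"
  shows "(1 - smult (1/p) [:0, 1:]) ^ 3 = normal_form K p {} 3"
  unfolding poly_eq_poly_eq_iff[symmetric] fun_eq_iff
proof
  fix x
  have p: "p \<noteq> 0" using assms by auto
  have "K * (x - p) ^ 3 = K * p ^ 3 * (x / p - 1) ^ 3"
    using p by (simp add: power_mult_distrib[symmetric] algebra_simps)
  also have "\<dots> = (1 - x / p) ^ 3"
    unfolding assms by (simp add: power3_eq_cube algebra_simps)
  finally show "poly ((1 - smult (1/p) [:0, 1:]) ^ 3) x = poly (normal_form K p {} 3) x"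
    by (simp add: normal_form_def)
qed

lemma normal_form_2b:
  assumes "K * D * p ^ 3 = 1"
  shows "(1 - smult (1/D) [:0, 1:]) * (1 - smult (1/p) [:0, 1:]) ^ 3 = normal_form K p {D} 3"
  unfolding poly_eq_poly_eq_iff[symmetric] fun_eq_iff
proof
  fix x
  have p: "p \<noteq> 0" "D \<noteq> 0" using assms by auto
  have "K * ((x - p) ^ 3 * (x - D)) = (K * D * p ^ 3) * ((x / p - 1) ^ 3 * (x / D - 1))"
  proof -
    have "x - p = p * (x / p - 1)" "x - D = D * (x / D - 1)" using p by (simp_all add: algebra_simps)
    then show ?thesis by (simp only: power_mult_distrib mult_ac)
  qed
  also have "\<dots> = (1 - x / D) * (1 - x / p) ^ 3"
  proof -
    have "(u - 1) ^ 3 * (v - 1) = (1 - v) * (1 - u) ^ 3" for u v :: complex by algebra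
    then show ?thesis unfolding assms by simp
  qed
  finally show "poly ((1 - smult (1/D) [:0, 1:]) * (1 - smult (1/p) [:0, 1:]) ^ 3) x = poly (normal_form K p {D} 3) x"
    by (simp add: normal_form_def del: mult_pCons_left mult_pCons_right)
qed

lemma normal_form_2c:
  "smult K ([:0, 1:] * ([:0, 1:] - 1) * ([:0, 1:] - [:p:]) ^ 3) = normal_form K p {0, 1} 3"
  unfolding poly_eq_poly_eq_iff[symmetric] fun_eq_iff
  by (simp add: normal_form_def algebra_simps)

text \<open>With \<open>u = (1 - x / p)^3\<close> the left side is \<open>4 * u * (1 - u)\<close>.
  Here \<open>p^3 * u\<close> is \<open>- (x - p)^3\<close>, and \<open>p^3 * (1 - u)\<close> is the
  product over the vertices by the first two hypotheses.\<close>

lemma normal_form_2d: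
  assumes "1 + D = 3 * p" "D = 3 * p\<^sup>2" "K * p ^ 6 = -4" "D \<noteq> 0" "D \<noteq> 1"
  shows "1 - 4 * ((1 - smult (1/p) [:0, 1:]) ^ 3 - [:1/2:])\<^sup>2 = normal_form K p {0, 1, D} 3"
  unfolding poly_eq_poly_eq_iff[symmetric] fun_eq_iff
proof
  fix x
  have p: "p \<noteq> 0" using assms by auto
  define u where "u = (1 - x / p) ^ 3"
  have up: "u * p ^ 3 = - ((x - p) ^ 3)"
  proof -
    have "u * p ^ 3 = ((1 - x / p) * p) ^ 3" by (simp add: u_def power_mult_distrib)
    also have "(1 - x / p) * p = p - x" using p by (simp add: algebra_simps)
    finally show ?thesis by (simp add: power3_eq_cube algebra_simps)
  qed
  \<comment> \<open>In the expanded cube, the coefficients \<open>-3 * p\<close> and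
    \<open>3 * p^2\<close> are those of the product on the right.\<close>
  have T: "(x - p) ^ 3 + p ^ 3 = x * ((x - 1) * (x - D))"
    using assms(1,2) by algebra
  have "p ^ 6 * (4 * (u * (1 - u))) = p ^ 6 * (K * ((x - p) ^ 3 * (x * ((x - 1) * (x - D)))))"
  proof -
    define X where "X = (x - p) ^ 3"
    define Y where "Y = x * ((x - 1) * (x - D))"
    have "p ^ 6 * (4 * (u * (1 - u))) = 4 * ((u * p ^ 3) * (p ^ 3 - u * p ^ 3))" by algebra
    also have "\<dots> = - 4 * (X * Y)"
      unfolding up T[folded X_def Y_def, symmetric] X_def by algebra
    also have "\<dots> = p ^ 6 * (K * (X * Y))"
      unfolding assms(3)[symmetric] by (simp only: mult_ac)
    finally show ?thesis unfolding X_def Y_def .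
  qed
  then have "4 * (u * (1 - u)) = K * ((x - p) ^ 3 * (x * ((x - 1) * (x - D))))"
    using p by simp
  moreover have "1 - 4 * (u - 1/2)\<^sup>2 = 4 * (u * (1 - u))"
    by (simp add: power2_eq_square field_simps)
  ultimately show "poly (1 - 4 * ((1 - smult (1/p) [:0, 1:]) ^ 3 - [:1/2:])\<^sup>2) x = poly (normal_form K p {0, 1, D} 3) x"
    using assms(4,5) by (simp add: normal_form_def u_def del: mult_pCons_left mult_pCons_right)
qed

text \<open>In this and the next two lemmas, \<open>p\<close> is the root with positive imaginary
  part of the quadratic polynomial left by the Pell equation, and \<open>D\<close> follows from the
  linear relation.\<close>

lemma equianharmonic_constants:
  defines "D \<equiv> Complex (1/2) (sqrt 3 / 2)" and "p \<equiv> Complex (1/2) (sqrt 3 / 6)"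
  shows "1 + D = 3 * p" "D = 3 * p\<^sup>2" "3 * p\<^sup>2 - 3 * p + 1 = 0" "D \<noteq> 0" "D \<noteq> 1" "p \<noteq> 0" "p \<notin> {0, 1, D}"
  by (auto simp: D_def p_def complex_eq_iff power2_eq_square)

lemma constants_2b:
  defines "D \<equiv> Complex (1/2) (5 * sqrt 2 / 4)" and "p \<equiv> Complex (1/2) (sqrt 2 / 4)"
  shows "D = 5 * p - 2" "8 * p\<^sup>2 - 8 * p + 3 = 0" "D \<noteq> 0" "D \<noteq> 1" "p \<noteq> 0" "p \<notin> {0, 1, D}"
  by (auto simp: D_def p_def complex_eq_iff power2_eq_square)

lemma constants_2c:
  defines "D \<equiv> Complex (1/2) (11 * sqrt 15 / 90)" and "p \<equiv> Complex (1/2) (sqrt 15 / 18)"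
    and "K \<equiv> Complex 0 (- (2025 * sqrt 15 / 64))"
  shows "5 * D = 11 * p - 3" "27 * p\<^sup>2 - 27 * p + 8 = 0" "K * D * p\<^sup>2 = 25" "D \<noteq> 0" "D \<noteq> 1" "p \<noteq> 0"
    "p \<notin> {0, 1, D}" "K \<noteq> 0"
  by (auto simp: D_def p_def K_def complex_eq_iff power2_eq_square)

text \<open>Both numbers are roots of the same quadratic polynomial, whose roots add up to
  1.\<close>

lemma conjugate_roots:
  fixes p c :: complex
  assumes "k * p\<^sup>2 - k * p + l = 0" "k * c\<^sup>2 - k * c + l = 0" "k \<noteq> 0"
  shows "p = c \<or> p = 1 - c"
proof -
  have "k * ((p - c) * (p - (1 - c))) = 0" using assms(1,2) by algebra
  then have "p - c = 0 \<or> p - (1 - c) = 0" using assms(3) by (simp only: mult_eq_0_iff) blast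
  then show ?thesis by simp
qed

text \<open>The data of the seven subcases; (2d) shares \<open>D\<close> and \<open>p\<^sub>0\<close> with (2a).\<close>

definition P1a :: "complex poly" where "P1a = [:0, 1:] * (2 - [:0, 1:])"
definition P1b :: "complex poly" where "P1b = ([:0, 1:] - 1)\<^sup>2 * (1 - smult (1/4) [:0, 1:])"
definition P1c :: "complex poly" where "P1c = 4 * ([:0, 1:] * (2 - [:0, 1:]) - [:1/2:])\<^sup>2"
definition P2a :: "complex \<Rightarrow> complex poly" where "P2a p = (1 - smult (1/p) [:0, 1:]) ^ 3"
definition P2b :: "complex \<Rightarrow> complex \<Rightarrow> complex poly" where
  "P2b D p = (1 - smult (1/D) [:0, 1:]) * (1 - smult (1/p) [:0, 1:]) ^ 3"
definition P2c :: "complex \<Rightarrow> complex \<Rightarrow> complex poly" where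
  "P2c K p = smult K ([:0, 1:] * ([:0, 1:] - 1) * ([:0, 1:] - [:p:]) ^ 3)"
definition P2d :: "complex \<Rightarrow> complex poly" where
  "P2d p = 4 * ((1 - smult (1/p) [:0, 1:]) ^ 3 - [:1/2:])\<^sup>2"

definition "D2a = Complex (1/2) (sqrt 3 / 2)"
definition "p2a = Complex (1/2) (sqrt 3 / 6)"
definition "D2b = Complex (1/2) (5 * sqrt 2 / 4)"
definition "p2b = Complex (1/2) (sqrt 2 / 4)"
definition "D2c = Complex (1/2) (11 * sqrt 15 / 90)"
definition "p2c = Complex (1/2) (sqrt 15 / 18)"
definition "K2c = Complex 0 (- (2025 * sqrt 15 / 64))"

lemmas const2a = equianharmonic_constants[folded D2a_def p2a_def]
lemmas const2b = constants_2b[folded D2b_def p2b_def]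
lemmas const2c = constants_2c[folded D2c_def p2c_def K2c_def]

section \<open>Sufficiency of the seven subcases\<close>

lemma card_triangle: "D \<noteq> 0 \<Longrightarrow> D \<noteq> 1 \<Longrightarrow> card {0, 1, D :: complex} = 3"
  by auto

lemma reducing_1a: "\<kappa> 0 = \<kappa> 2 \<Longrightarrow> reducing {0, 1, 2} \<kappa> 1 P1a"
proof -
  assume *: "\<kappa> 0 = \<kappa> 2"
  \<comment> \<open>\<open>C\<close> solves \<open>2 * C = \<kappa> 1\<close>, the condition at
    \<open>p = 1\<close>; \<open>C'\<close> is read off at the two other vertices, where the
    exponents agree.\<close>
  have "reducing {0, 1, 2} \<kappa> 1 (normal_form 1 1 {} 2)"
    by (rule reducing_normal_form[where C = "\<kappa> 1 / 2" and C' = "\<kappa> 0 - 1/2"])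
      (use * in \<open>auto simp: pell_normal_form_1a insert_Diff_if\<close>)
  then have "reducing {0, 1, 2} \<kappa> 1 (1 - P1a)" by (simp only: normal_form_1a P1a_def)
  then show ?thesis using reducing_complement by force
qed

lemma reducing_1b: "1 - \<kappa> 1 = 2 * (1 - \<kappa> 4) \<Longrightarrow> \<kappa> 0 = 1/2 \<Longrightarrow> reducing {0, 1, 4} \<kappa> 1 P1b"
proof -
  assume *: "1 - \<kappa> 1 = 2 * (1 - \<kappa> 4)" "\<kappa> 0 = 1/2"
  \<comment> \<open>The vertex 4 is a zero, which gives \<open>C\<close> and forces
    \<open>C' = 0\<close>, whence \<open>\<kappa> 0 = 1/2\<close>. The other restriction is the
    condition \<open>\<kappa> 1 = 2 * C\<close> at \<open>p = 1\<close>.\<close>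
  have "reducing {0, 1, 4} \<kappa> 1 (normal_form (-1/4) 1 {4} 2)"
    by (rule reducing_normal_form[where C = "\<kappa> 4 - 1/2" and C' = 0])
      (use * in \<open>auto simp: pell_normal_form_1b insert_Diff_if algebra_simps\<close>)
  then show ?thesis by (simp only: normal_form_1b P1b_def)
qed

lemma reducing_1c:
  assumes *: "\<kappa> 0 = \<kappa> 2" "1 - \<kappa> 1 = 2 * (1 - \<kappa> 0)"
  shows "reducing {0, 1, 2} \<kappa> 1 P1c"
proof -
  have "reducing {0, 1, 2} \<kappa> 1 (normal_form (-4) 1 {0, 2} 2)"
    by (rule reducing_normal_form[where C = "\<kappa> 0 - 1/2" and C' = 0])
      (use * in \<open>auto simp: pell_normal_form_1c insert_Diff_if algebra_simps\<close>)
  then have "reducing {0, 1, 2} \<kappa> 1 (1 - P1c)" by (simp only: normal_form_1c P1c_def)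
  then show ?thesis using reducing_complement by force
qed

lemma reducing_2a:
  assumes "\<forall>x\<in>{0, 1, D2a}. \<kappa> x = \<kappa> 0"
  shows "reducing {0, 1, D2a} \<kappa> p2a (P2a p2a)"
proof -
  note c = const2a
  have K: "(-1 / p2a ^ 3) * p2a ^ 3 = -1" using c(6) by simp
  \<comment> \<open>As \<open>p2a\<close> is no vertex, the condition there reads
    \<open>3 * C = 1/2\<close>. The value 1/6 recurs in the other non-degenerate subcases for the
    same reason.\<close>
  have "reducing {0, 1, D2a} \<kappa> p2a (normal_form (-1 / p2a ^ 3) p2a {} 3)"
    by (rule reducing_normal_form[OF card_triangle, where C = "1/6" and C' = "\<kappa> 0 - 1/2"])
      (use c K assms in \<open>auto simp: pell_normal_form_2a\<close>)
  then show ?thesis unfolding P2a_def normal_form_2a[OF K] .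
qed

lemma reducing_2b:
  assumes "\<kappa> D2b = 2/3" "\<kappa> 0 = 1/2" "\<kappa> 1 = 1/2"
  shows "reducing {0, 1, D2b} \<kappa> p2b (P2b D2b p2b)"
proof -
  note c = const2b
  define K where "K = 1 / (D2b * p2b ^ 3)"
  have K: "K * D2b * p2b ^ 3 = 1" "K \<noteq> 0" using c(3,5) by (simp_all add: K_def)
  have "reducing {0, 1, D2b} \<kappa> p2b (normal_form K p2b {D2b} 3)"
    by (rule reducing_normal_form[OF card_triangle, where C = "1/6" and C' = 0])
      (use c K assms in \<open>auto simp: pell_normal_form_2b mult.commute\<close>)
  then show ?thesis unfolding P2b_def normal_form_2b[OF K(1)] .
qed

lemma reducing_2c:
  assumes "\<kappa> D2c = 1/2" "\<kappa> 0 = 2/3" "\<kappa> 1 = 2/3"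
  shows "reducing {0, 1, D2c} \<kappa> p2c (P2c K2c p2c)"
proof -
  note c = const2c
  have "reducing {0, 1, D2c} \<kappa> p2c (normal_form K2c p2c {0, 1} 3)"
    by (rule reducing_normal_form[OF card_triangle, where C = "1/6" and C' = 0])
      (use c assms in \<open>auto simp: pell_normal_form_2c mult.commute\<close>)
  then show ?thesis unfolding P2c_def normal_form_2c .
qed

lemma reducing_2d:
  assumes "\<forall>x\<in>{0, 1, D2a}. \<kappa> x = 2/3"
  shows "reducing {0, 1, D2a} \<kappa> p2a (P2d p2a)"
proof -
  note c = const2a
  define K where "K = -4 / p2a ^ 6"
  have K: "K * p2a ^ 6 = -4" "K \<noteq> 0" using c(6) by (simp_all add: K_def)
  have "reducing {0, 1, D2a} \<kappa> p2a (normal_form K p2a {0, 1, D2a} 3)"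
    by (rule reducing_normal_form[OF card_triangle, where C = "1/6" and C' = 0])
      (use c K assms in \<open>auto simp: pell_normal_form_2d mult.commute\<close>)
  then have "reducing {0, 1, D2a} \<kappa> p2a (1 - P2d p2a)"
    unfolding P2d_def normal_form_2d[OF c(1,2) K(1) c(4,5)] .
  then show ?thesis using reducing_complement by force
qed

text \<open>In the two equianharmonic entries the restriction is symmetric in the vertices; it is
  stated on \<open>E\<close> and does not depend on the chosen map.\<close>

definition listed_subcase :: "complex set \<Rightarrow> (complex \<Rightarrow> complex) \<Rightarrow> complex \<Rightarrow> complex poly \<Rightarrow> bool" where
  "listed_subcase E \<kappa> p r \<longleftrightarrow>
     (subcase_of E \<kappa> p r 2 1 (\<lambda>\<kappa>. \<kappa> 0 = \<kappa> 2) P1a \<or>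
      subcase_of E \<kappa> p r 4 1 (\<lambda>\<kappa>. 1 - \<kappa> 1 = 2 * (1 - \<kappa> 4) \<and> \<kappa> 0 = 1/2) P1b \<or>
      subcase_of E \<kappa> p r 2 1 (\<lambda>\<kappa>. \<kappa> 0 = \<kappa> 2 \<and> 1 - \<kappa> 1 = 2 * (1 - \<kappa> 0) \<and> 2 * (1 - \<kappa> 0) = 2 * (1 - \<kappa> 2)) P1c) \<or>
     subcase_of E \<kappa> p r D2a p2a (\<lambda>_. \<exists>k. \<forall>e\<in>E. \<kappa> e = k) (P2a p2a) \<or>
     subcase_of E \<kappa> p r D2b p2b (\<lambda>\<kappa>. \<kappa> D2b = 2/3 \<and> \<kappa> 0 = 1/2 \<and> \<kappa> 1 = 1/2) (P2b D2b p2b) \<or>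
     subcase_of E \<kappa> p r D2c p2c (\<lambda>\<kappa>. \<kappa> D2c = 1/2 \<and> \<kappa> 0 = 2/3 \<and> \<kappa> 1 = 2/3) (P2c K2c p2c) \<or>
     subcase_of E \<kappa> p r D2a p2a (\<lambda>_. \<forall>e\<in>E. \<kappa> e = 2/3) (P2d p2a)"

lemma reducing_if_listed_subcase:
  assumes "card E = 3" "listed_subcase E \<kappa> p r"
  shows "reducing E \<kappa> p r"
proof -
  have const: "\<forall>x\<in>{0, 1, D}. \<kappa>' x = k" if "\<kappa>' ` {0, 1, D} = \<kappa> ` E" "\<forall>e\<in>E. \<kappa> e = k" for \<kappa>' D k
  proof
    fix x assume "x \<in> {0, 1, D}"
    then have "\<kappa>' x \<in> \<kappa> ` E" unfolding that(1)[symmetric] by (rule imageI)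
    then show "\<kappa>' x = k" using that(2) by auto
  qed
  have red2a: "reducing {0, 1, D2a} \<kappa>' p2a (P2a p2a)"
    if "\<exists>k. \<forall>e\<in>E. \<kappa> e = k" "\<kappa>' ` {0, 1, D2a} = \<kappa> ` E" for \<kappa>'
  proof -
    from that(1) obtain k where "\<forall>e\<in>E. \<kappa> e = k" by blast
    then have "\<forall>x\<in>{0, 1, D2a}. \<kappa>' x = k" by (rule const[OF that(2)])
    then show ?thesis by (intro reducing_2a) simp
  qed
  have red2d: "reducing {0, 1, D2a} \<kappa>' p2a (P2d p2a)"
    if "\<forall>e\<in>E. \<kappa> e = 2/3" "\<kappa>' ` {0, 1, D2a} = \<kappa> ` E" for \<kappa>'
    using const[OF that(2,1)] by (rule reducing_2d)
  note intro = reducing_if_subcase_of[OF _ assms(1)]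
  show ?thesis
    using assms(2) unfolding listed_subcase_def
  proof (elim disjE, goal_cases)
    case 1
    then show ?case by (rule intro) (rule reducing_1a)
  next
    case 2
    then show ?case by (rule intro) (blast intro: reducing_1b)
  next
    case 3
    then show ?case by (rule intro) (blast intro: reducing_1c)
  next
    case 4
    then show ?case by (rule intro) (rule red2a)
  next
    case 5
    then show ?case by (rule intro) (blast intro: reducing_2b)
  next
    case 6
    then show ?case by (rule intro) (blast intro: reducing_2c)
  next
    case 7
    then show ?case by (rule intro) (rule red2d)
  qed
qed

section \<open>Necessity of the seven subcases\<close>

lemma subset_of_three:
  assumes "card E = 3" "Z \<subseteq> E"
  obtains x y z where "x \<noteq> y" "z \<noteq> x" "z \<noteq> y" "E = {x, y, z}"
    "Z = {} \<or> Z = {z} \<or> Z = {x, y} \<or> Z = {x, y, z}"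
proof -
  have fin: "finite E" "finite Z" using assms by (metis card.infinite zero_neq_numeral finite_subset)+
  have "card Z \<le> 3" using assms fin by (metis card_mono)
  then consider "card Z = 0" | "card Z = 1" | "card Z = 2" | "card Z = 3" by linarith
  then show thesis
  proof cases
    case 1
    then have "Z = {}" using fin by simp
    moreover obtain x y z where "E = {x, y, z}" "x \<noteq> y" "y \<noteq> z" "x \<noteq> z"
      using assms(1) by (auto simp: card_3_iff)
    ultimately show thesis using that[of x y z] by auto
  next
    case 2
    then obtain z where z: "Z = {z}" by (auto simp: card_1_singleton_iff)
    then have "card (E - {z}) = 2" using assms fin by simp
    then obtain x y where "E - {z} = {x, y}" "x \<noteq> y" by (auto simp: card_2_iff)
    then show thesis using that[of x y z] z assms(2) by auto
  next
    case 3
    then obtain x y where xy: "Z = {x, y}" "x \<noteq> y" by (auto simp: card_2_iff)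
    have "card (E - Z) = 1" using 3 assms fin by (simp add: card_Diff_subset)
    then obtain z where "E - Z = {z}" by (auto simp: card_1_singleton_iff)
    then show thesis using that[of x y z] xy assms(2) by auto
  next
    case 4
    then have "Z = E" using assms fin by (metis card_subset_eq)
    moreover obtain x y z where "E = {x, y, z}" "x \<noteq> y" "y \<noteq> z" "x \<noteq> z"
      using assms(1) by (auto simp: card_3_iff)
    ultimately show thesis using that[of x y z] by auto
  qed
qed

lemma subset_of_two:
  assumes "card F = 2" "Z \<subseteq> F"
  obtains x z where "x \<noteq> z" "F = {x, z}" "Z = {} \<or> Z = {z} \<or> Z = {x, z}"
proof -
  obtain x z where F: "F = {x, z}" "x \<noteq> z" using assms(1) by (auto simp: card_2_iff)
  then have "Z = {} \<or> Z = {z} \<or> Z = {x} \<or> Z = {x, z}" using assms(2) by auto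
  then show thesis using that[of x z] that[of z x] F by (auto simp: insert_commute)
qed

text \<open>By \<open>reducing_cases\<close>, \<open>r\<close> or \<open>1 - r\<close> is in normal
  form. If \<open>p\<close> is a vertex, the number of zeros among the two other vertices gives
  three subcases; otherwise the number of zeros among all three gives four. The balance conditions
  yield the exponents, and the Pell equation yields the triangle, \<open>p\<close> and the
  polynomial.\<close>

lemma listed_subcase_if_reducing:
  assumes "card E = 3" "reducing E \<kappa> p r" "p \<in> E \<longrightarrow> \<kappa> p \<noteq> 0"
  shows "listed_subcase E \<kappa> p r"
proof -
  define m where "m = card (E - {p})"
  note card = card_Diff_center(1)[OF assms(1), of p, folded m_def]
  obtain S K Z where S: "S = r \<or> S = 1 - r" and red: "reducing E \<kappa> p S" and K: "K \<noteq> 0"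
    and Z: "Z \<subseteq> E - {p}" and nf: "S = normal_form K p Z m"
    using reducing_cases[OF assms] unfolding m_def by blast
  obtain C C' where pell: "pell E p S" and bal: "balanced E \<kappa> p S C C'"
    using red by (auto simp: reducing_def)
  have C': "Z \<noteq> {} \<Longrightarrow> C' = 0" and C: "of_nat m * C = of_bool (p \<in> E) * (\<kappa> p - 1/2) + 1/2"
    and eq: "\<And>e. e \<in> Z \<Longrightarrow> C = \<kappa> e - 1/2" and eq': "\<And>e. e \<in> E - {p} - Z \<Longrightarrow> C' = \<kappa> e - 1/2"
    using iffD1[OF balanced_normal_form_iff[OF assms(1) K Z nf[unfolded m_def] pell] bal, folded m_def] by blast+
  show ?thesis
  proof (cases "p \<in> E")
    case True
    then have m: "m = 2" using card by simp
    note nf = nf[unfolded m]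
    \<comment> \<open>If just one of the two other vertices is a zero, it is called
      \<open>z\<close>. The coordinate sends \<open>x\<close> to 0 and \<open>p\<close> to 1, so the
      image of \<open>z\<close> is the unknown third vertex.\<close>
    obtain x z where xz: "x \<noteq> z" "E - {p} = {x, z}" "Z = {} \<or> Z = {z} \<or> Z = {x, z}"
      using subset_of_two[of "E - {p}" Z] m m_def Z by metis
    then have E: "E = {x, p, z}" and dist: "x \<noteq> p" "z \<noteq> x" "z \<noteq> p" using True by auto
    define A where "A = affine_coord x p"
    have A: "poly A x = 0" "poly A p = 1" using dist(1) by (simp_all add: A_def affine_coord)
    note intro = subcase_of_normal_form[OF dist E K nf pell S A_def A(2)]
    have p: "\<kappa> p = 2 * C" using C m True by simp
    from xz(3) consider "Z = {}" | "Z = {z}" | "Z = {x, z}" by blast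
    then show ?thesis
    proof cases
      case 1
      have "\<kappa> x = \<kappa> z" using eq'[of x] eq'[of z] xz(2) 1 by simp
      then have "subcase_of E \<kappa> p r 2 1 (\<lambda>\<kappa>. \<kappa> 0 = \<kappa> 2) P1a"
        using normal_form_1a 1 unfolding P1a_def
        by (intro intro[where Z' = "\<lambda>_. {}"]) (simp_all add: pell_normal_form_1a)
      then show ?thesis unfolding listed_subcase_def by blast
    next
      case 2
      \<comment> \<open>A zero vertex makes \<open>C' = 0\<close>, so the vertex \<open>x\<close>,
        which is not a zero, has exponent parameter 1/2.\<close>
      have "\<kappa> x = 1/2" "\<kappa> z = C + 1/2" using eq'[of x] eq[of z] C' xz(1,2) 2 by simp_all
      then have "subcase_of E \<kappa> p r 4 1 (\<lambda>\<kappa>. 1 - \<kappa> 1 = 2 * (1 - \<kappa> 4) \<and> \<kappa> 0 = 1/2) P1b"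
        using normal_form_1b 2 p unfolding P1b_def
        by (intro intro[where Z' = "\<lambda>D. {D}"]) (simp_all add: pell_normal_form_1b)
      then show ?thesis unfolding listed_subcase_def by blast
    next
      case 3
      have "\<kappa> x = C + 1/2" "\<kappa> z = C + 1/2" using eq[of x] eq[of z] 3 by simp_all
      then have "subcase_of E \<kappa> p r 2 1 (\<lambda>\<kappa>. \<kappa> 0 = \<kappa> 2 \<and> 1 - \<kappa> 1 = 2 * (1 - \<kappa> 0) \<and>
          2 * (1 - \<kappa> 0) = 2 * (1 - \<kappa> 2)) P1c"
        using normal_form_1c 3 p A unfolding P1c_def
        by (intro intro[where Z' = "\<lambda>D. {0, D}"]) (simp_all add: pell_normal_form_1c)
      then show ?thesis unfolding listed_subcase_def by blast
    qed
  next
    case False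
    then have m: "m = 3" using card by simp
    \<comment> \<open>This is the origin of the parameter 2/3: vertices that are zeros have
      \<open>\<kappa> e = C + 1/2\<close>.\<close>
    have C6: "C = 1/6" using C m False by (simp add: mult.commute)
    note nf = nf[unfolded m]
    have ZE: "Z \<subseteq> E" using Z by blast
    \<comment> \<open>The labels make \<open>x\<close> and \<open>y\<close> interchangeable:
      \<open>z\<close> is the only vertex in \<open>Z\<close>, or the only one outside it, or all
      three are alike.\<close>
    obtain x y z where dist: "x \<noteq> y" "z \<noteq> x" "z \<noteq> y" and E: "E = {x, y, z}"
      and Zs: "Z = {} \<or> Z = {z} \<or> Z = {x, y} \<or> Z = {x, y, z}"
      by (rule subset_of_three[OF assms(1) ZE])
    note intro = subcase_of_normal_form_up_to_conjugation[OF dist E K nf pell S]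
    have pE: "p \<noteq> x" "p \<noteq> y" "p \<noteq> z" using False E by auto
    have A: "poly (affine_coord x' y') x' = 0" "poly (affine_coord x' y') y' = 1" "x' \<noteq> y'"
      if "{x', y'} = {x, y}" for x' y'
      using that dist(1) by (auto simp: affine_coord doubleton_eq_iff)
    from Zs consider "Z = {}" | "Z = {z}" | "Z = {x, y}" | "Z = {x, y, z}" by blast
    then show ?thesis
    proof cases
      case 1
      have "subcase_of E \<kappa> p r D2a p2a (\<lambda>_. \<exists>k. \<forall>e\<in>E. \<kappa> e = k) (P2a p2a)"
      proof (rule intro[where Z' = "\<lambda>_. {}"])
        fix K' D' p' assume "K' \<noteq> 0" "D' \<noteq> 0" "D' \<noteq> 1" "pell {0, 1, D'} p' (normal_form K' p' {} 3)"
        \<comment> \<open>The third vertex is eliminated from \<open>1 + D' = 3 * p'\<close> and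
          \<open>D' = 3 * p'^2\<close>.\<close>
        then have "3 * p'\<^sup>2 - 3 * p' + 1 = 0" by (simp add: pell_normal_form_2a) algebra
        then show "p' = p2a \<or> p' = 1 - p2a" using const2a(3) by (rule conjugate_roots) simp
      next
        fix K' D' assume *: "K' \<noteq> 0" "D' \<noteq> 0" "D' \<noteq> 1" "pell {0, 1, D'} p2a (normal_form K' p2a {} 3)"
        then have e: "1 + D' = 3 * p2a" and K': "K' * p2a ^ 3 = -1"
          unfolding pell_normal_form_2a[OF *(1-3)] by blast+
        have "1 + D' = 1 + D2a" unfolding e const2a(1) ..
        then have "D' = D2a" by (simp only: add_left_cancel)
        then show "D' = D2a \<and> (P2a p2a = normal_form K' p2a {} 3 \<or> 1 - P2a p2a = normal_form K' p2a {} 3)"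
          using normal_form_2a[OF K'] unfolding P2a_def by blast
      next
        show "\<exists>k. \<forall>e\<in>E. \<kappa> e = k"
        proof (intro exI ballI)
          fix e assume "e \<in> E"
          then have "C' = \<kappa> e - 1/2" using eq' 1 False by auto
          then show "\<kappa> e = C' + 1/2" by simp
        qed
      qed (use 1 in auto)
      then show ?thesis unfolding listed_subcase_def by blast
    next
      case 2
      have "subcase_of E \<kappa> p r D2b p2b (\<lambda>\<kappa>. \<kappa> D2b = 2/3 \<and> \<kappa> 0 = 1/2 \<and> \<kappa> 1 = 1/2) (P2b D2b p2b)"
      proof (rule intro[where Z' = "\<lambda>D. {D}"])
        fix K' D' p' assume "K' \<noteq> 0" "D' \<noteq> 0" "D' \<noteq> 1" "pell {0, 1, D'} p' (normal_form K' p' {D'} 3)"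
        then have "8 * p'\<^sup>2 - 8 * p' + 3 = 0" by (simp add: pell_normal_form_2b)
        then show "p' = p2b \<or> p' = 1 - p2b" using const2b(2) by (rule conjugate_roots) simp
      next
        fix K' D' assume *: "K' \<noteq> 0" "D' \<noteq> 0" "D' \<noteq> 1" "pell {0, 1, D'} p2b (normal_form K' p2b {D'} 3)"
        then have e: "D' = 5 * p2b - 2" and K': "K' * D' * p2b ^ 3 = 1"
          unfolding pell_normal_form_2b[OF *(1-3)] by blast+
        have D': "D' = D2b" unfolding e const2b(1) ..
        have "P2b D2b p2b = normal_form K' p2b {D2b} 3"
          unfolding P2b_def by (rule normal_form_2b[OF K'[unfolded D']])
        then show "D' = D2b \<and> (P2b D2b p2b = normal_form K' p2b {D2b} 3 \<or> 1 - P2b D2b p2b = normal_form K' p2b {D2b} 3)"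
          using D' by blast
      next
        fix x' y' \<kappa>' assume "{x', y'} = {x, y}" "\<kappa>' 0 = \<kappa> x'" "\<kappa>' 1 = \<kappa> y'" "\<kappa>' D2b = \<kappa> z"
        moreover have "\<kappa> z = C + 1/2" "\<kappa> x = 1/2" "\<kappa> y = 1/2" using eq[of z] eq'[of x] eq'[of y] C' 2 E dist pE by auto
        ultimately show "\<kappa>' D2b = 2/3 \<and> \<kappa>' 0 = 1/2 \<and> \<kappa>' 1 = 1/2"
          using C6 by (auto simp: doubleton_eq_iff)
      qed (use 2 in auto)
      then show ?thesis unfolding listed_subcase_def by blast
    next
      case 3
      have "subcase_of E \<kappa> p r D2c p2c (\<lambda>\<kappa>. \<kappa> D2c = 1/2 \<and> \<kappa> 0 = 2/3 \<and> \<kappa> 1 = 2/3) (P2c K2c p2c)"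
      proof (rule intro[where Z' = "\<lambda>_. {0, 1}"])
        fix K' D' p' assume "K' \<noteq> 0" "D' \<noteq> 0" "D' \<noteq> 1" "pell {0, 1, D'} p' (normal_form K' p' {0, 1} 3)"
        then have "27 * p'\<^sup>2 - 27 * p' + 8 = 0" by (simp add: pell_normal_form_2c)
        then show "p' = p2c \<or> p' = 1 - p2c" using const2c(2) by (rule conjugate_roots) simp
      next
        fix K' D' assume *: "K' \<noteq> 0" "D' \<noteq> 0" "D' \<noteq> 1" "pell {0, 1, D'} p2c (normal_form K' p2c {0, 1} 3)"
        then have e: "5 * D' = 11 * p2c - 3" and K': "K' * D' * p2c\<^sup>2 = 25"
          unfolding pell_normal_form_2c[OF *(1-3)] by blast+
        have "5 * D' = 5 * D2c" unfolding e const2c(1) ..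
        then have D': "D' = D2c" by simp
        \<comment> \<open>\<open>K2c\<close> satisfies the same equation as \<open>K'\<close>, and
          its coefficient \<open>D2c * p2c^2\<close> is nonzero.\<close>
        have "K' * (D2c * p2c\<^sup>2) = K2c * (D2c * p2c\<^sup>2)"
          using K' const2c(3) unfolding D' by (simp only: mult.assoc)
        then have "K' = K2c" using const2c(4,6) by simp
        then show "D' = D2c \<and> (P2c K2c p2c = normal_form K' p2c {0, 1} 3 \<or> 1 - P2c K2c p2c = normal_form K' p2c {0, 1} 3)"
          using D' unfolding P2c_def normal_form_2c by blast
      next
        fix x' y' \<kappa>' assume "{x', y'} = {x, y}" "\<kappa>' 0 = \<kappa> x'" "\<kappa>' 1 = \<kappa> y'" "\<kappa>' D2c = \<kappa> z"
        moreover have "\<kappa> z = 1/2" "\<kappa> x = C + 1/2" "\<kappa> y = C + 1/2" using eq'[of z] eq[of x] eq[of y] C' 3 E dist pE by auto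
        ultimately show "\<kappa>' D2c = 1/2 \<and> \<kappa>' 0 = 2/3 \<and> \<kappa>' 1 = 2/3"
          using C6 by (auto simp: doubleton_eq_iff)
      next
        fix x' y' assume *: "{x', y'} = {x, y}"
        then have "Z = {x', y'}" using 3 by simp
        then show "poly (affine_coord x' y') ` Z = {0, 1}"
          by (simp only: image_insert image_empty A(1,2)[OF *])
      qed
      then show ?thesis unfolding listed_subcase_def by blast
    next
      case 4
      have "subcase_of E \<kappa> p r D2a p2a (\<lambda>_. \<forall>e\<in>E. \<kappa> e = 2/3) (P2d p2a)"
      proof (rule intro[where Z' = "\<lambda>D. {0, 1, D}"])
        fix K' D' p' assume "K' \<noteq> 0" "D' \<noteq> 0" "D' \<noteq> 1" "pell {0, 1, D'} p' (normal_form K' p' {0, 1, D'} 3)"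
        then have "3 * p'\<^sup>2 - 3 * p' + 1 = 0" by (simp add: pell_normal_form_2d) algebra
        then show "p' = p2a \<or> p' = 1 - p2a" using const2a(3) by (rule conjugate_roots) simp
      next
        fix K' D' assume *: "K' \<noteq> 0" "D' \<noteq> 0" "D' \<noteq> 1" "pell {0, 1, D'} p2a (normal_form K' p2a {0, 1, D'} 3)"
        then have e: "1 + D' = 3 * p2a" and K': "K' * p2a ^ 6 = -4"
          unfolding pell_normal_form_2d[OF *(1-3)] by blast+
        have "1 + D' = 1 + D2a" unfolding e const2a(1) ..
        then have D': "D' = D2a" by (simp only: add_left_cancel)
        have "1 - P2d p2a = normal_form K' p2a {0, 1, D2a} 3"
          unfolding P2d_def by (rule normal_form_2d[OF const2a(1,2) K' const2a(4,5)])
        then show "D' = D2a \<and> (P2d p2a = normal_form K' p2a {0, 1, D2a} 3 \<or> 1 - P2d p2a = normal_form K' p2a {0, 1, D2a} 3)"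
          using D' by blast
      next
        show "\<forall>e\<in>E. \<kappa> e = 2/3"
        proof
          fix e assume "e \<in> E"
          then have "C = \<kappa> e - 1/2" using eq 4 E by auto
          then show "\<kappa> e = 2/3" using C6 by (simp add: mult.commute)
        qed
      next
        fix x' y' assume *: "{x', y'} = {x, y}"
        then have "Z = {x', y', z}" using 4 by auto
        then show "poly (affine_coord x' y') ` Z = {0, 1, poly (affine_coord x' y') z}"
          by (simp only: image_insert image_empty A(1,2)[OF *])
      qed
      then show ?thesis unfolding listed_subcase_def by blast
    qed
  qed
qed

text \<open>The value 1 is a vertex of the normalized triangle, and \<open>A\<close> is injective.
  This yields the clause on \<open>q / (\<alpha> * \<beta>)\<close> in the degenerate
  subcases.\<close>

lemma center_in_vertices_if_subcase_of:
  assumes "subcase_of E \<kappa> p r D 1 restr P"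
  shows "p \<in> E"
proof -
  from assms obtain A where A: "degree A = 1" "poly A ` E = {0, 1, D}" "poly A p = 1"
    by (auto simp: subcase_of_def)
  then have "poly A p \<in> poly A ` E" by simp
  then show ?thesis using inj_image_mem_iff[OF inj_degree1[OF A(1)]] by blast
qed

lemma reducing_iff_listed_subcase:
  assumes "card E = 3" "p \<in> E \<longrightarrow> \<kappa> p \<noteq> 0"
  shows "reducing E \<kappa> p r \<longleftrightarrow> listed_subcase E \<kappa> p r"
  using listed_subcase_if_reducing[OF assms(1)] reducing_if_listed_subcase[OF assms(1)] assms(2) by blast

theorem theorem3p1:
  fixes d q \<alpha> \<beta> \<gamma> \<delta> \<epsilon> :: complex and R :: ratfun
  assumes "d \<noteq> 0" and "d \<noteq> 1"
    and "\<alpha> + \<beta> - \<gamma> - \<delta> - \<epsilon> + 1 = 0"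
    and "heun_four_singular_points d q \<alpha> \<beta> \<gamma> \<delta> \<epsilon>"
    and "\<not> heun_trivial q \<alpha> \<beta>"
  shows "(\<exists>a b c. heun_reduced_by d q \<alpha> \<beta> \<gamma> \<delta> \<epsilon> a b c R) \<longleftrightarrow>
    R \<in> range to_fract \<and> \<alpha> * \<beta> \<noteq> 0 \<and>
    (let subcase = reduction_subcase d (q / (\<alpha> * \<beta>)) \<gamma> \<delta> \<epsilon> R;
         t = [:0, 1:]
     in
      q / (\<alpha> * \<beta>) \<in> {0, 1, d} \<and>
      (subcase 2 1 (\<lambda>\<kappa>. \<kappa> 0 = \<kappa> 2)
         (t * (2 - t)) \<or>
       subcase 4 1 (\<lambda>\<kappa>. 1 - \<kappa> 1 = 2 * (1 - \<kappa> 4) \<and> \<kappa> 0 = 1/2)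
         ((t - 1)^2 * (1 - smult (1/4) t)) \<or>
       subcase 2 1 (\<lambda>\<kappa>. \<kappa> 0 = \<kappa> 2 \<and>
           1 - \<kappa> 1 = 2 * (1 - \<kappa> 0) \<and> 2 * (1 - \<kappa> 0) = 2 * (1 - \<kappa> 2))
         (4 * (t * (2 - t) - [:1/2:])^2))
      \<or>
      (let D = Complex (1/2) (sqrt 3 / 2); p\<^sub>0 = Complex (1/2) (sqrt 3 / 6) in
       subcase D p\<^sub>0 (\<lambda>\<kappa>. \<gamma> = \<delta> \<and> \<delta> = \<epsilon>)
         ((1 - smult (1/p\<^sub>0) t)^3)) \<or>
      (let D = Complex (1/2) (5 * sqrt 2 / 4); p\<^sub>0 = Complex (1/2) (sqrt 2 / 4) in
       subcase D p\<^sub>0 (\<lambda>\<kappa>. \<kappa> D = 2/3 \<and> \<kappa> 0 = 1/2 \<and> \<kappa> 1 = 1/2)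
         ((1 - smult (1/D) t) * (1 - smult (1/p\<^sub>0) t)^3)) \<or>
      (let D = Complex (1/2) (11 * sqrt 15 / 90); p\<^sub>0 = Complex (1/2) (sqrt 15 / 18) in
       subcase D p\<^sub>0 (\<lambda>\<kappa>. \<kappa> D = 1/2 \<and> \<kappa> 0 = 2/3 \<and> \<kappa> 1 = 2/3)
         (smult (Complex 0 (- (2025 * sqrt 15 / 64))) (t * (t - 1) * (t - [:p\<^sub>0:])^3))) \<or>
      (let D = Complex (1/2) (sqrt 3 / 2); p\<^sub>0 = Complex (1/2) (sqrt 3 / 6) in
       subcase D p\<^sub>0 (\<lambda>\<kappa>. \<gamma> = 2/3 \<and> \<delta> = 2/3 \<and> \<epsilon> = 2/3)
         (4 * ((1 - smult (1/p\<^sub>0) t)^3 - [:1/2:])^2)))"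
proof -
  let ?E = "{0, 1, d}" and ?\<kappa> = "exponent_param \<gamma> \<delta> \<epsilon>" and ?p = "q / (\<alpha> * \<beta>)"
  \<comment> \<open>Nontriviality states that the numerator of \<open>heun_coeff0\<close> is not the
    zero polynomial.\<close>
  have L: "[:-q, \<alpha> * \<beta>:] \<noteq> 0" using assms(5) by (auto simp: heun_trivial_def)
  show ?thesis
  proof (cases "R \<in> range to_fract \<and> \<alpha> * \<beta> \<noteq> 0")
    case False
    have "R \<in> range to_fract" if "heun_reduced_by d q \<alpha> \<beta> \<gamma> \<delta> \<epsilon> a b c R" for a b c
      using that pole_free_pullback[OF _ L assms(1,2)] unfolding heun_reduced_by_def by blast
    then have "\<not> (\<exists>a b c. heun_reduced_by d q \<alpha> \<beta> \<gamma> \<delta> \<epsilon> a b c R)"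
      using False heun_reduced_by_to_fract_iff[OF assms(1,2) L] by blast
    then show ?thesis using False by blast
  next
    case True
    then obtain r where R: "R = to_fract r" and ab: "\<alpha> * \<beta> \<noteq> 0" by blast
    have card: "card ?E = 3" using assms(1,2) by (rule card_triangle)
    \<comment> \<open>The four singular points enter here: if \<open>?p\<close> is a vertex, the
      numerator of \<open>heun_coeff0\<close> cancels the factor of this vertex in the denominator,
      and a vanishing exponent parameter would make it an ordinary point.\<close>
    have "?p \<in> ?E \<longrightarrow> ?\<kappa> ?p \<noteq> 0"
    proof
      assume "?p \<in> ?E"
      then consider "?p = 0" | "?p = 1" | "?p = d" by blast
      then show "?\<kappa> ?p \<noteq> 0"
      proof cases
        case 1
        then have "q = 0" using ab by simp
        then show ?thesis
          unfolding 1 using assms(4) by (simp add: exponent_param_def heun_four_singular_points_def)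
      next
        case 2
        then have "q = \<alpha> * \<beta>" using ab by simp
        then show ?thesis
          unfolding 2 using assms(4) by (simp add: exponent_param_def heun_four_singular_points_def)
      next
        case 3
        then have "q = \<alpha> * \<beta> * d" using ab by (simp add: field_simps)
        then show ?thesis
          unfolding 3 using assms(1,2,4) by (simp add: exponent_param_def heun_four_singular_points_def)
      qed
    qed
    then have iff: "(\<exists>a b c. heun_reduced_by d q \<alpha> \<beta> \<gamma> \<delta> \<epsilon> a b c R) \<longleftrightarrow> listed_subcase ?E ?\<kappa> ?p r"
      unfolding R heun_reduced_by_to_fract_iff[OF assms(1,2) L]
      using reducing_iff_listed_subcase[OF card] ab by blast
    \<comment> \<open>As 0, 1 and \<open>d\<close> are distinct, the symmetric restrictions on
      \<open>E\<close> become conditions on \<open>\<gamma>\<close>, \<open>\<delta>\<close> and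
      \<open>\<epsilon>\<close>.\<close>
    have restr2a: "(\<exists>k. \<forall>e\<in>?E. ?\<kappa> e = k) \<longleftrightarrow> \<gamma> = \<delta> \<and> \<delta> = \<epsilon>"
      using assms(1,2) by (auto simp: exponent_param_def)
    have restr2d: "(\<forall>e\<in>?E. ?\<kappa> e = 2/3) \<longleftrightarrow> \<gamma> = 2/3 \<and> \<delta> = 2/3 \<and> \<epsilon> = 2/3"
      using assms(1,2) by (auto simp: exponent_param_def)
    show ?thesis
      unfolding iff
      unfolding listed_subcase_def restr2a restr2d Let_def R reduction_subcase_iff
        P1a_def P1b_def P1c_def P2a_def P2b_def P2c_def P2d_def
        D2a_def p2a_def D2b_def p2b_def D2c_def p2c_def K2c_def
      using ab center_in_vertices_if_subcase_of[of ?E ?\<kappa> ?p r] rangeI[of to_fract r] by blast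
  qed
qed

end
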